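(* Let $\gamma>-5$ be real, let $p,q\in\mathbb{N}^3$ be multi-indices and let $s,t\in\{1,2,3\}$. Then $$G_{st}(\gamma,p,q)=\int_{\mathbb{R}^3}|g|^{\gamma}g_sg_tH^{p}(g)H^{q}(g)\mathcal{M}(g)\,\mathrm{d}g$$ is given by $$G_{st}(\gamma,p,q)=2^{(\gamma+2)/2}\sum_{|\hat p|_B=|p|}\ \sum_{|\hat q|_B=|q|}C_{\hat p}^{p}\,C_{\hat q}^{q}\,D_{\hat p_3,\hat q_3}^{\hat p_1\hat q_1}\,K\!\left(\frac{\gamma+\hat p_1+\hat q_1+3}{2},\ \hat p_1+\frac12,\ \hat q_1+\frac12,\ \hat p_3,\ \hat q_3\right)F_{st}(\hat p_1,\hat p_2,\hat q_1,\hat q_2),$$ where $$F_{st}(\hat p_1,\hat p_2,\hat q_1,\hat q_2)=\int_{\mathbb{S}^2}n_sn_t\,Y_{\hat p_1}^{\hat p_2}(n)\,Y_{\hat q_1}^{\hat q_2}(n)\,\mathrm{d}n,$$ with $n_s,n_t$ the $s$-th and $t$-th entries of the unit vector $n=(\sin\theta\cos\phi,\sin\theta\sin\phi,\cos\theta)^T$, $$D_{n_1n_2}^{l_1l_2}=\sqrt{\frac{n_1!\,n_2!}{\Gamma(n_1+l_1+3/2)\,\Gamma(n_2+l_2+3/2)}},$$ and $$K(\mu,\alpha,\kappa,m,n)=(-1)^{m+n}\,\Gamma(\mu+1)\sum_{i=0}^{\min(m,n)}\binom{\mu-\alpha}{m-i}\binom{\mu-\kappa}{n-i}\binom{i+\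mu}{i}.$$
   Context: $\mathbb{N}=\{0,1,2,\dots\}$. For $\alpha\in\mathbb{N}^3$, $|\alpha|=\alpha_1+\alpha_2+\alpha_3$. $\mathcal{M}(v)=(2\pi)^{-3/2}\exp(-|v|^2/2)$, $v\in\mathbb{R}^3$. Hermite polynomials: $H^{\alpha}(v)=\frac{(-1)^{|\alpha|}}{\mathcal{M}(v)}\frac{\partial^{|\alpha|}}{\partial v_1^{\alpha_1}\partial v_2^{\alpha_2}\partial v_3^{\alpha_3}}\mathcal{M}(v)$. Burnett indices are triples $\hat\alpha=(\hat\alpha_1,\hat\alpha_2,\hat\alpha_3)$ with $\hat\alpha_1,\hat\alpha_3\in\mathbb{N}$ and $\hat\alpha_2\in\{-\hat\alpha_1,\dots,\hat\alpha_1\}$; $|\hat\alpha|_B=\hat\alpha_1+2\hat\alpha_3$. The sums in the claim run over all Burnett indices $\hat p$ with $|\hat p|_B=|p|$ and $\hat q$ with $|\hat q|_B=|q|$. The normalized Burnett polynomials are $$B_{\hat\alpha}(v)=\sqrt{\frac{2^{1-\hat\alpha_1}\pi^{3/2}\hat\alpha_3!}{\Gamma(\hat\alpha_3+\hat\alpha_1+3/2)}}\;L_{\hat\alpha_3}^{(\hat\alpha_1+1/2)}\!\left(\frac{|v|^2}{2}\right)|v|^{\hat\alpha_1}\,Y_{\hat\alpha_1}^{\hat\alpha_2}\!\left(\frac{v}{|v|}\right),$$ where $L_n^{(\beta)}(x)=\frac{x^{-\beta}e^{x}}{n!}\frac{\mathrm{d}^n}{\mathrm{d}x^n}\big[x^{n+\beta}e^{-x}\big]$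 are the Laguerre polynomials and $Y_l^m$ ($l\in\mathbb{N}$, $-l\le m\le l$) are the spherical harmonics $$Y_l^m(n)=\sqrt{\frac{2l+1}{4\pi}\frac{(l-m)!}{(l+m)!}}\,P_l^m(\cos\theta)\,e^{\mathrm{i}m\phi},\qquad n=(\sin\theta\cos\phi,\sin\theta\sin\phi,\cos\theta)^T,$$ with $P_l^m(x)=\frac{(-1)^m}{2^ll!}(1-x^2)^{m/2}\frac{\mathrm{d}^{l+m}}{\mathrm{d}x^{l+m}}\big[(x^2-1)^l\big]$. They are orthonormal: $\int_{\mathbb{R}^3}\overline{B_{\hat\alpha}}B_{\hat\beta}\mathcal{M}\,\mathrm{d}v=\delta_{\hat\alpha,\hat\beta}$. The numbers $C_{\hat\alpha}^{\alpha}$ are the coefficients of the Hermite polynomials in the Burnett basis: $$H^{\alpha}(v)=\sum_{|\hat\alpha|_B=|\alpha|}C_{\hat\alpha}^{\alpha}B_{\hat\alpha}(v),\qquad C_{\hat\alpha}^{\alpha}=\int_{\mathbb{R}^3}\overline{B_{\hat\alpha}(v)}\,H^{\alpha}(v)\,\mathcal{M}(v)\,\mathrm{d}v.$$ Binomial coefficients with real upper entry are generalized: $\binom{x}{k}=\frac{x(x-1)\cdots(x-k+1)}{k!}$ for $k\in\mathbb{N}$, $x\in\mathbb{R}$. $\mathrm{d}n$ is the surface measure on the unit sphere $\mathbb{S}^2$. *)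

theory Defs
  imports "HOL-Analysis.Analysis"
begin

definition msize :: "nat ^ 3 \<Rightarrow> nat" where
  "msize \<alpha> = \<alpha> $ 1 + \<alpha> $ 2 + \<alpha> $ 3"

definition maxwellian :: "real ^ 3 \<Rightarrow> real" where
  "maxwellian v = (2 * pi) powr (- 3 / 2) * exp (- (norm v)\<^sup>2 / 2)"

definition partial_deriv :: "3 \<Rightarrow> (real ^ 3 \<Rightarrow> real) \<Rightarrow> real ^ 3 \<Rightarrow> real" where
  "partial_deriv i f v = deriv (\<lambda>h. f (v + h *\<^sub>R axis i 1)) 0"

definition hermite :: "nat ^ 3 \<Rightarrow> real ^ 3 \<Rightarrow> real" where
  "hermite \<alpha> v = (- 1) ^ msize \<alpha> / maxwellian v *
     (partial_deriv 1 ^^ (\<alpha> $ 1)) ((partial_deriv 2 ^^ (\<alpha> $ 2))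
       ((partial_deriv 3 ^^ (\<alpha> $ 3)) maxwellian)) v"

definition laguerre_rodrigues :: "nat \<Rightarrow> real \<Rightarrow> real \<Rightarrow> real" where
  "laguerre_rodrigues n \<beta> x = x powr (- \<beta>) * exp x / fact n *
     (deriv ^^ n) (\<lambda>y. y powr (real n + \<beta>) * exp (- y)) x"

text \<open>The Rodrigues formula is meaningful only for positive arguments; the value of the
  polynomial at \<open>0\<close> is its limit there.\<close>

definition laguerre :: "nat \<Rightarrow> real \<Rightarrow> real \<Rightarrow> real" where
  "laguerre n \<beta> x =
     (if x = 0 then Lim (at_right 0) (laguerre_rodrigues n \<beta>) else laguerre_rodrigues n \<beta> x)"

text \<open>For \<open>-1 \<le> x \<le> 1\<close>, \<open>sqrt (1 - x\<^sup>2) powi m\<close> is \<open>(1 - x\<^sup>2)\<close> to the power \<open>m / 2\<close>. At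
  \<open>x = -1\<close> and \<open>x = 1\<close>, unlike \<open>powr\<close>, it gives \<open>1\<close> for \<open>m = 0\<close>; for \<open>m < 0\<close> it gives \<open>0\<close>, which is
  the limit of the whole expression.\<close>

definition assoc_legendre :: "nat \<Rightarrow> int \<Rightarrow> real \<Rightarrow> real" where
  "assoc_legendre l m x = (- 1) powi m / (2 ^ l * fact l) * sqrt (1 - x\<^sup>2) powi m *
     (deriv ^^ nat (int l + m)) (\<lambda>y. (y\<^sup>2 - 1) ^ l) x"

definition sph_harm_angle :: "nat \<Rightarrow> int \<Rightarrow> real \<Rightarrow> real \<Rightarrow> complex" where
  "sph_harm_angle l m \<theta> \<phi> =
     of_real (sqrt ((2 * real l + 1) / (4 * pi) * (fact (nat (int l - m)) / fact (nat (int l + m)))) *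
       assoc_legendre l m (cos \<theta>)) * exp (\<i> * of_int m * of_real \<phi>)"

definition unit_vec :: "real \<times> real \<Rightarrow> real ^ 3" where
  "unit_vec = (\<lambda>(\<theta>, \<phi>). vector [sin \<theta> * cos \<phi>, sin \<theta> * sin \<phi>, cos \<theta>])"

definition sph_harm :: "nat \<Rightarrow> int \<Rightarrow> real ^ 3 \<Rightarrow> complex" where
  "sph_harm l m n = sph_harm_angle l m (arccos (n $ 3)) (Arg (Complex (n $ 1) (n $ 2)))"

text \<open>Surface measure on the unit sphere: the image of \<open>sin \<theta> d\<theta> d\<phi>\<close> under the spherical
  parametrization, \<open>sin \<theta>\<close> being the area element of \<open>unit_vec\<close>.\<close>

definition sphere_measure :: "(real ^ 3) measure" where
  "sphere_measure =
     distr (density lborel (\<lambda>(\<theta>, \<phi>). indicator ({0..pi} \<times> {0..2 * pi}) (\<theta>, \<phi>) * ennreal (sin \<theta>)))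
       (restrict_space borel (sphere 0 1)) unit_vec"

text \<open>A Burnett index is a triple \<open>(l, m, n)\<close> with \<open>-l \<le> m \<le> l\<close>, of weight \<open>l + 2 * n\<close>.\<close>

definition burnett_indices :: "nat \<Rightarrow> (nat \<times> int \<times> nat) set" where
  "burnett_indices N = {(l, m, n). \<bar>m\<bar> \<le> int l \<and> l + 2 * n = N}"

definition burnett :: "nat \<times> int \<times> nat \<Rightarrow> real ^ 3 \<Rightarrow> complex" where
  "burnett = (\<lambda>(l, m, n) v.
     of_real (sqrt (2 powi (1 - int l) * pi powr (3 / 2) * fact n / Gamma (real n + real l + 3 / 2)) *
       laguerre n (real l + 1 / 2) ((norm v)\<^sup>2 / 2) * norm v ^ l) *
     sph_harm l m (v /\<^sub>R norm v))"

definition burnett_coeff :: "nat ^ 3 \<Rightarrow> nat \<times> int \<times> nat \<Rightarrow> complex" where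
  "burnett_coeff \<alpha> a =
     (LINT v|lborel. cnj (burnett a v) * of_real (hermite \<alpha> v) * of_real (maxwellian v))"

definition G_integrand :: "3 \<Rightarrow> 3 \<Rightarrow> real \<Rightarrow> nat ^ 3 \<Rightarrow> nat ^ 3 \<Rightarrow> real ^ 3 \<Rightarrow> real" where
  "G_integrand s t \<gamma> p q g =
     norm g powr \<gamma> * g $ s * g $ t * hermite p g * hermite q g * maxwellian g"

definition G_int :: "3 \<Rightarrow> 3 \<Rightarrow> real \<Rightarrow> nat ^ 3 \<Rightarrow> nat ^ 3 \<Rightarrow> real" where
  "G_int s t \<gamma> p q = (LINT g|lborel. G_integrand s t \<gamma> p q g)"

definition F_int :: "3 \<Rightarrow> 3 \<Rightarrow> nat \<Rightarrow> int \<Rightarrow> nat \<Rightarrow> int \<Rightarrow> complex" where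
  "F_int s t l1 m1 l2 m2 =
     (LINT n|sphere_measure. of_real (n $ s * n $ t) * sph_harm l1 m1 n * sph_harm l2 m2 n)"

definition D_coeff :: "nat \<Rightarrow> nat \<Rightarrow> nat \<Rightarrow> nat \<Rightarrow> real" where
  "D_coeff l1 l2 n1 n2 =
     sqrt (fact n1 * fact n2 / (Gamma (real n1 + real l1 + 3 / 2) * Gamma (real n2 + real l2 + 3 / 2)))"

definition K_sum :: "real \<Rightarrow> real \<Rightarrow> real \<Rightarrow> nat \<Rightarrow> nat \<Rightarrow> real" where
  "K_sum \<mu> \<alpha> \<kappa> m n = (- 1) ^ (m + n) * Gamma (\<mu> + 1) *
     (\<Sum>i = 0..min m n. ((\<mu> - \<alpha>) gchoose (m - i)) * ((\<mu> - \<kappa>) gchoose (n - i)) * ((real i + \<mu>) gchoose i))"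

lemma finite_burnett_indices: "finite (burnett_indices N)"
proof (rule finite_subset)
  show "burnett_indices N \<subseteq> {..N} \<times> {- int N..int N} \<times> {..N}"
    by (auto simp: burnett_indices_def)
qed auto

lemma norm_unit_vec: "norm (unit_vec x) = 1"
proof -
  have "(sin a * cos b)\<^sup>2 + (sin a * sin b)\<^sup>2 + (cos a)\<^sup>2 = 1" for a b :: real
    using sin_cos_squared_add[of a] sin_cos_squared_add[of b] by algebra
  then show ?thesis
    by (cases x) (simp add: unit_vec_def norm_vec_def L2_set_def sum_3)
qed

lemma measurable_unit_vec: "unit_vec \<in> borel \<rightarrow>\<^sub>M restrict_space borel (sphere 0 1)"
proof (rule measurable_restrict_space2)
  have "continuous_on UNIV (\<lambda>x. unit_vec x $ i)" for i
  proof -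
    have "continuous_on UNIV (\<lambda>x. unit_vec x $ 1)" "continuous_on UNIV (\<lambda>x. unit_vec x $ 2)"
      "continuous_on UNIV (\<lambda>x. unit_vec x $ 3)"
      unfolding unit_vec_def case_prod_beta vector_3 by (intro continuous_intros)+
    then show ?thesis
      using exhaust_3[of i] by auto
  qed
  then have "continuous_on UNIV (\<lambda>x. \<chi> i. unit_vec x $ i)"
    by (intro continuous_on_vec_lambda)
  then show "unit_vec \<in> borel_measurable borel"
    by (intro borel_measurable_continuous_onI) simp
qed (simp add: norm_unit_vec)

lemma sph_harm_unit_vec:
  assumes "0 \<le> \<theta>" "\<theta> \<le> pi"
  shows "sph_harm l m (unit_vec (\<theta>, \<phi>)) = sph_harm_angle l m \<theta> \<phi>"
proof -
  let ?z = "Complex (sin \<theta> * cos \<phi>) (sin \<theta> * sin \<phi>)"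
  have eq: "sph_harm l m (unit_vec (\<theta>, \<phi>)) = sph_harm_angle l m \<theta> (Arg ?z)"
    using assms by (simp add: sph_harm_def unit_vec_def arccos_cos)
  have e: "exp (\<i> * of_int m * of_real x) = cis x powi m" for x
    by (simp add: cis_power_int) (simp add: cis_conv_exp mult_ac)
  show ?thesis
  proof (cases "sin \<theta> = 0")
    case True
    then have c: "(cos \<theta>)\<^sup>2 = 1"
      using sin_cos_squared_add[of \<theta>] by simp
    show ?thesis
    proof (cases "m = 0")
      case True
      then show ?thesis unfolding eq by (simp add: sph_harm_angle_def)
    next
      case False
      then have "assoc_legendre l m (cos \<theta>) = 0"
        by (simp add: assoc_legendre_def c power_int_0_left_if)
      then show ?thesis unfolding eq by (simp add: sph_harm_angle_def)
    qed
  next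
    case False
    with assms have pos: "sin \<theta> > 0"
      using sin_ge_zero[of \<theta>] by linarith
    have z: "?z = of_real (sin \<theta>) * cis \<phi>"
      by (simp add: complex_eq_iff)
    have "cis (Arg ?z) = sgn ?z"
      using pos z by (intro cis_Arg) (auto simp del: Complex_eq_0)
    also have "\<dots> = cis \<phi>"
      unfolding z using pos by (simp add: sgn_eq norm_mult)
    finally show ?thesis
      unfolding eq sph_harm_angle_def e by simp
  qed
qed

end

theory Submission
  imports Defs "HOL-Computational_Algebra.Polynomial" "HOL-Computational_Algebra.Formal_Power_Series"
begin

text \<open>
  In polar coordinates a Burnett polynomial is a Laguerre polynomial in \<open>|g|\<^sup>2 / 2\<close> times
  \<open>|g|\<^sup>l\<close> times a spherical harmonic. After both Hermite polynomials are expanded in the Burnett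
  basis, every term of the integrand is therefore a radial function times a function of direction,
  and its integral is a radial integral times the spherical integral \<open>F\<close>. With \<open>x = |g|\<^sup>2 / 2\<close> and
  \<open>\<mu> = (\<gamma> + l + l' + 3) / 2\<close> the radial integral is \<open>\<integral> x\<^sup>\<mu> e\<^sup>-\<^sup>x L\<^sub>n L\<^sub>n\<^sub>' dx\<close> up to a power of two, and it
  equals \<open>K\<close>: each of the two Laguerre polynomials is re-expanded in the family with parameter \<open>\<mu>\<close>,
  which is orthogonal for the weight \<open>x\<^sup>\<mu> e\<^sup>-\<^sup>x\<close> (\<open>laguerre_poly_connection\<close>,
  \<open>gamma_moment_laguerre_K\<close>). The integral converges because
  \<open>\<gamma> > - 5\<close> is just what makes \<open>\<mu> > - 1\<close> for all \<open>l, l' \<ge> 0\<close>.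

  That the Hermite polynomial of index \<open>\<alpha>\<close> is a combination of Burnett functions of weight \<open>|\<alpha>|\<close>
  (\<open>hermite_in_burnett_span\<close>) follows by building it up one derivative at a time. On polynomials
  multiplied by the Maxwellian, \<open>- \<partial>\<^sub>i\<close> acts as \<open>v\<^sub>i - \<partial>\<^sub>i\<close>. If \<open>S\<close> is a solid harmonic of degree \<open>l\<close>, then
  \<open>v\<^sub>i S = A + |v|\<^sup>2 B\<close> with \<open>A\<close> a solid harmonic of degree \<open>l + 1\<close> and \<open>B = \<partial>\<^sub>i S / (2 l + 1)\<close> one of degree
  \<open>l - 1\<close>; two Laguerre identities then show that \<open>v\<^sub>i - \<partial>\<^sub>i\<close> maps \<open>L\<^sub>n S\<close> to \<open>L\<^sub>n A\<close> minus a multiple of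
  \<open>L\<^sub>n\<^sub>+\<^sub>1 B\<close>, with the parameters shifted accordingly. Both terms have weight one higher. The statements
  about solid harmonics are read off from the Laurent expansion of \<open>(z + a u + b / u)\<^sup>l\<close>, with
  \<open>a = \<i> (x + \<i> y) / 2\<close> and \<open>b = \<i> (x - \<i> y) / 2\<close>, whose coefficients they are.

  The coefficients of the expansion are the numbers \<open>C\<close> because the Burnett functions of one weight
  are orthonormal. This rests on the orthogonality of the spherical harmonics, which is integration
  by parts for the derivatives of \<open>(x\<^sup>2 - 1)\<^sup>l\<close>, and on the case \<open>\<mu> = l + 1 / 2\<close> of the same radial
  integral.
\<close>

section \<open>Solid harmonics as Laurent coefficients\<close>

definition xy_plus :: "real ^ 3 \<Rightarrow> complex" where
  "xy_plus v = \<i> / 2 * Complex (v $ 1) (v $ 2)"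

definition xy_minus :: "real ^ 3 \<Rightarrow> complex" where
  "xy_minus v = \<i> / 2 * Complex (v $ 1) (- v $ 2)"

text \<open>The coefficient of \<open>u\<^sup>m\<close> in \<open>(z + a u + b / u)\<^sup>l\<close>, where \<open>z\<close> is the third coordinate of \<open>v\<close>,
  \<open>a = xy_plus v\<close> and \<open>b = xy_minus v\<close>; one more factor gives the recursion. For each \<open>u\<close> the bracket is
  a linear form whose coefficient vector has square zero, so its powers are harmonic. Up to a constant
  this is \<open>|v|\<^sup>l\<close> times the spherical harmonic \<open>Y\<^sub>l\<^sup>m\<close> at \<open>v / |v|\<close> (see \<open>sph_harm_eq_solid\<close>).\<close>

primrec solid :: "nat \<Rightarrow> int \<Rightarrow> real ^ 3 \<Rightarrow> complex" where
  "solid 0 m v = (if m = 0 then 1 else 0)"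
| "solid (Suc l) m v = of_real (v $ 3) * solid l m v +
     xy_plus v * solid l (m - 1) v + xy_minus v * solid l (m + 1) v"

lemma solid_eq_0: "int l < \<bar>m\<bar> \<Longrightarrow> solid l m v = 0"
  by (induction l arbitrary: m) auto

lemma xy_plus_scaleR [simp]: "xy_plus (c *\<^sub>R v) = of_real c * xy_plus v"
  and xy_minus_scaleR [simp]: "xy_minus (c *\<^sub>R v) = of_real c * xy_minus v"
  and xy_plus_add [simp]: "xy_plus (v + w) = xy_plus v + xy_plus w"
  and xy_minus_add [simp]: "xy_minus (v + w) = xy_minus v + xy_minus w"
  by (simp_all add: xy_plus_def xy_minus_def complex_eq_iff field_simps)

lemma solid_scaleR: "solid l m (c *\<^sub>R v) = of_real c ^ l * solid l m v"
  by (induction l arbitrary: m) (simp_all add: algebra_simps)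

lemma norm_sq_eq: "of_real ((norm v)\<^sup>2) = of_real (v $ 3) ^ 2 - 4 * xy_plus v * xy_minus v"
proof -
  have "(norm v)\<^sup>2 = (v $ 1)\<^sup>2 + (v $ 2)\<^sup>2 + (v $ 3)\<^sup>2"
    by (simp add: norm_vec_def L2_set_def sum_3)
  then show ?thesis
    by (simp add: xy_plus_def xy_minus_def complex_eq_iff power2_eq_square)
qed

text \<open>Compare coefficients in \<open>E f\<^sup>l\<^sup>+\<^sup>1 = (l + 1) f\<^sup>l E f\<close>, where \<open>f = z + a u + b / u\<close> and
  \<open>E = u d/du\<close> multiplies the coefficient of \<open>u\<^sup>m\<close> by \<open>m\<close> and satisfies \<open>E f = a u - b / u\<close>.\<close>

lemma solid_order:
  "of_int m * solid (Suc l) m v =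
     of_nat (Suc l) * (xy_plus v * solid l (m - 1) v - xy_minus v * solid l (m + 1) v)"
proof (induction l arbitrary: m)
  case 0
  show ?case by (cases "m = 1"; cases "m = -1") auto
next
  case (Suc l)
  let ?a = "xy_plus v" and ?b = "xy_minus v" and ?z = "of_real (v $ 3) :: complex"
  let ?S = "\<lambda>l m. solid l m v"
  have 1: "of_int m * ?S (Suc l) (m - 1) =
      of_nat (Suc l) * (?a * ?S l (m - 2) - ?b * ?S l m) + ?S (Suc l) (m - 1)"
    using Suc.IH[of "m - 1"] by (simp add: algebra_simps del: solid.simps)
  have 2: "of_int m * ?S (Suc l) (m + 1) =
      of_nat (Suc l) * (?a * ?S l m - ?b * ?S l (m + 2)) - ?S (Suc l) (m + 1)"
    using Suc.IH[of "m + 1"] by (simp add: algebra_simps del: solid.simps)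
  have e1: "?S (Suc l) (m - 1) = ?z * ?S l (m - 1) + ?a * ?S l (m - 2) + ?b * ?S l m"
    and e2: "?S (Suc l) (m + 1) = ?z * ?S l (m + 1) + ?a * ?S l m + ?b * ?S l (m + 2)"
    by (simp_all add: add.commute)
  have "of_int m * ?S (Suc (Suc l)) m =
     ?z * (of_int m * ?S (Suc l) m) + ?a * (of_int m * ?S (Suc l) (m - 1)) +
     ?b * (of_int m * ?S (Suc l) (m + 1))"
    by (simp only: solid.simps(2)[of "Suc l"] algebra_simps)
  also have "\<dots> = (of_nat (Suc l) + 1) * (?a * ?S (Suc l) (m - 1) - ?b * ?S (Suc l) (m + 1))"
    unfolding 1 2 Suc.IH[of m] unfolding e1 e2 by algebra
  finally show ?case by (simp only: of_nat_Suc add.commute)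
qed

text \<open>Applying \<open>E = u d/du\<close> twice to a power of \<open>f = z + a u + b / u\<close> produces \<open>(a u - b / u)\<^sup>2\<close>, which
  is \<open>f\<^sup>2 - 2 z f + |v|\<^sup>2\<close> because \<open>z\<^sup>2 - 4 a b = |v|\<^sup>2\<close>. The outcome is a three-term recurrence in \<open>l\<close>.\<close>

lemma solid_order_sq:
  assumes "0 < l"
  shows "((of_nat (Suc l))\<^sup>2 - (of_int m)\<^sup>2) * solid (Suc l) m v =
    of_nat (Suc l) * (of_nat (2 * l + 1) * of_real (v $ 3) * solid l m v
      - of_nat l * of_real ((norm v)\<^sup>2) * solid (l - 1) m v)"
proof -
  obtain k where l: "l = Suc k"
    using assms by (cases l) auto
  let ?a = "xy_plus v" and ?b = "xy_minus v" and ?z = "of_real (v $ 3) :: complex"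
  let ?S = "\<lambda>l m. solid l m v"
  let ?n = "of_nat k :: complex" and ?m = "of_int m :: complex"
  have 1: "?m * ?S (Suc k) (m - 1) = (?n + 1) * (?a * ?S k (m - 2) - ?b * ?S k m) + ?S (Suc k) (m - 1)"
    using solid_order[of "m - 1" k v] by (simp add: algebra_simps del: solid.simps)
  have 2: "?m * ?S (Suc k) (m + 1) = (?n + 1) * (?a * ?S k m - ?b * ?S k (m + 2)) - ?S (Suc k) (m + 1)"
    using solid_order[of "m + 1" k v] by (simp add: algebra_simps del: solid.simps)
  have 3: "?m * ?S (Suc (Suc k)) m = (?n + 2) * (?a * ?S (Suc k) (m - 1) - ?b * ?S (Suc k) (m + 1))"
    using solid_order[of m "Suc k" v] by (simp add: algebra_simps del: solid.simps)
  have e0: "?S (Suc (Suc k)) m = ?z * ?S (Suc k) m + ?a * ?S (Suc k) (m - 1) + ?b * ?S (Suc k) (m + 1)"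
    and e1: "?S (Suc k) m = ?z * ?S k m + ?a * ?S k (m - 1) + ?b * ?S k (m + 1)"
    and e2: "?S (Suc k) (m - 1) = ?z * ?S k (m - 1) + ?a * ?S k (m - 2) + ?b * ?S k m"
    and e3: "?S (Suc k) (m + 1) = ?z * ?S k (m + 1) + ?a * ?S k m + ?b * ?S k (m + 2)"
    by (simp_all add: add.commute)
  have "?m\<^sup>2 * ?S (Suc (Suc k)) m = (?n + 2) * (?a * (?m * ?S (Suc k) (m - 1)) - ?b * (?m * ?S (Suc k) (m + 1)))"
    using 3 by algebra
  then show ?thesis
    unfolding l norm_sq_eq 
    using 1 2 e0 e1 e2 e3 
    by (simp del: solid.simps) algebra
qed

lemma solid_times_z:
  "of_nat (2 * l + 1) * of_real (v $ 3) * solid l m v =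
     of_nat l * of_real ((norm v)\<^sup>2) * solid (l - 1) m v +
     ((of_nat (Suc l))\<^sup>2 - (of_int m)\<^sup>2) / of_nat (Suc l) * solid (Suc l) m v"
proof (cases "l = 0")
  case True
  then show ?thesis
    by (cases "m = 1"; cases "m = -1") auto
next
  case False
  then show ?thesis
    using solid_order_sq[of l m v] 
    by (simp add: field_simps del: solid.simps of_nat_Suc)
qed

text \<open>Twice \<open>a u\<close> is \<open>(f - z) + (a u - b / u)\<close> for \<open>f = z + a u + b / u\<close>: the first bracket is handled by
  \<open>solid_times_z\<close>, the second by \<open>solid_order\<close>.\<close>

lemma solid_times_plus:
  "2 * of_nat (2 * l + 1) * xy_plus v * solid l m v =
     - of_nat l * of_real ((norm v)\<^sup>2) * solid (l - 1) (m + 1) v +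
     of_int ((m + 1 + int l) * (m + 2 + int l)) / of_nat (Suc l) * solid (Suc l) (m + 1) v"
proof -
  let ?a = "xy_plus v" and ?b = "xy_minus v" and ?z = "of_real (v $ 3) :: complex"
  let ?S = "\<lambda>l m. solid l m v"
  let ?n = "of_nat l :: complex" and ?m = "of_int m :: complex"
  have n: "?n + 1 \<noteq> 0"
    by (metis of_nat_Suc add.commute of_nat_neq_0)
  have 1: "(?m + 1) / (?n + 1) * ?S (Suc l) (m + 1) = ?a * ?S l m - ?b * ?S l (m + 2)"
    using solid_order[of "m + 1" l v] n
    by (simp add: field_simps del: solid.simps)
  have 2: "?S (Suc l) (m + 1) = ?z * ?S l (m + 1) + ?a * ?S l m + ?b * ?S l (m + 2)"
    by (simp add: add.commute)
  define X where "X = ?S (Suc l) (m + 1)"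
  have 3: "(2 * ?n + 1) * ?z * ?S l (m + 1) = ?n * of_real ((norm v)\<^sup>2) * ?S (l - 1) (m + 1) +
      ((?n + 1)\<^sup>2 - (?m + 1)\<^sup>2) / (?n + 1) * X"
    using solid_times_z[of l v "m + 1"] by (simp add: X_def add.commute del: solid.simps)
  have "2 * ?a * ?S l m = X - ?z * ?S l (m + 1) + (?m + 1) / (?n + 1) * X"
    using 1 2 unfolding X_def by algebra
  then have "2 * (2 * ?n + 1) * ?a * ?S l m = 
     (2 * ?n + 1) * (X + (?m + 1) / (?n + 1) * X) - (2 * ?n + 1) * ?z * ?S l (m + 1)"
    by algebra
  also have "\<dots> = - ?n * of_real ((norm v)\<^sup>2) * ?S (l - 1) (m + 1) +
     (?m + 1 + ?n) * (?m + 2 + ?n) / (?n + 1) * X"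
  proof -
    have "(2 * ?n + 1) * (1 + (?m + 1) / (?n + 1)) - ((?n + 1)\<^sup>2 - (?m + 1)\<^sup>2) / (?n + 1) =
      (?m + 1 + ?n) * (?m + 2 + ?n) / (?n + 1)"
      using n by (simp add: divide_simps) algebra
    then show ?thesis
      unfolding 3 by algebra
  qed
  finally show ?thesis
    by (simp add: X_def add.commute del: solid.simps)
qed

text \<open>The reflection \<open>y \<mapsto> - y\<close> exchanges \<open>a\<close> and \<open>b\<close>, hence \<open>u\<close> and \<open>1 / u\<close>; it carries facts about \<open>xy_plus\<close>
  over to \<open>xy_minus\<close>.\<close>

definition xy_flip :: "real ^ 3 \<Rightarrow> real ^ 3" where
  "xy_flip v = vector [v $ 1, - v $ 2, v $ 3]"

lemma solid_xy_flip: "solid l m (xy_flip v) = solid l (- m) v"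
proof (induction l arbitrary: m)
  case (Suc l)
  have "xy_plus (xy_flip v) = xy_minus v" "xy_minus (xy_flip v) = xy_plus v" "xy_flip v $ 3 = v $ 3"
    by (simp_all add: xy_flip_def xy_plus_def xy_minus_def)
  moreover have "- (m - 1) = - m + 1" "- (m + 1) = - m - 1" by simp_all
  ultimately show ?case 
    using Suc by (simp only: solid.simps ac_simps)
qed auto

lemma solid_times_minus:
  "2 * of_nat (2 * l + 1) * xy_minus v * solid l m v =
     - of_nat l * of_real ((norm v)\<^sup>2) * solid (l - 1) (m - 1) v +
     of_int ((int l + 1 - m) * (int l + 2 - m)) / of_nat (Suc l) * solid (Suc l) (m - 1) v"
proof -
  have "xy_plus (xy_flip v) = xy_minus v"
    by (simp add: xy_flip_def xy_plus_def xy_minus_def)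
  moreover have "norm (xy_flip v) = norm v"
    by (simp add: norm_vec_def L2_set_def sum_3 xy_flip_def)
  moreover have "- (- m + 1) = m - 1" by simp
  ultimately show ?thesis
    using solid_times_plus[of l "xy_flip v" "- m"] unfolding solid_xy_flip
    by (simp add: algebra_simps del: solid.simps)
qed

text \<open>The derivative of \<open>solid l m\<close> in direction \<open>e\<close>, as \<open>has_vector_derivative_solid\<close> shows.\<close>

definition solid_lower :: "real ^ 3 \<Rightarrow> nat \<Rightarrow> int \<Rightarrow> real ^ 3 \<Rightarrow> complex" where
  "solid_lower e l m v = of_nat l * (of_real (e $ 3) * solid (l - 1) m v +
     xy_plus e * solid (l - 1) (m - 1) v + xy_minus e * solid (l - 1) (m + 1) v)"

text \<open>The harmonic part of \<open>(e \<bullet> v) solid l m v\<close>, multiplied by \<open>2 l + 1\<close>; the decomposition is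
  \<open>inner_times_solid\<close>.\<close>

definition solid_raise :: "real ^ 3 \<Rightarrow> nat \<Rightarrow> int \<Rightarrow> real ^ 3 \<Rightarrow> complex" where
  "solid_raise e l m v = (of_int ((int l + 1)\<^sup>2 - m\<^sup>2) * of_real (e $ 3) * solid (Suc l) m v
     - of_int ((int l + 1 - m) * (int l + 2 - m)) * xy_plus e * solid (Suc l) (m - 1) v
     - of_int ((m + 1 + int l) * (m + 2 + int l)) * xy_minus e * solid (Suc l) (m + 1) v) / of_nat (Suc l)"

text \<open>In the null coordinates \<open>a, b, z\<close> the form \<open>e \<bullet> v\<close> is \<open>e\<^sub>3 z - 2 b\<^sub>e a - 2 a\<^sub>e b\<close>, so multiplication by it
  reduces to multiplication by \<open>z\<close>, \<open>a\<close> and \<open>b\<close>. The terms with \<open>|v|\<^sup>2\<close> combine to the derivative of the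
  solid harmonic, which is the reason why the operator \<open>v\<^sub>i - \<partial>\<^sub>i\<close> acts so simply.\<close>

lemma inner_times_solid:
  "of_nat (2 * l + 1) * of_real (e \<bullet> v) * solid l m v =
     of_real ((norm v)\<^sup>2) * solid_lower e l m v + solid_raise e l m v"
proof -
  have e: "of_real (e \<bullet> v) = of_real (e $ 3) * of_real (v $ 3) - 2 * xy_minus e * xy_plus v - 2 * xy_plus e * xy_minus v"
    by (simp add: inner_vec_def sum_3 xy_plus_def xy_minus_def complex_eq_iff field_simps)
  have "of_nat (2 * l + 1) * of_real (e \<bullet> v) * solid l m v =
     of_real (e $ 3) * (of_nat (2 * l + 1) * of_real (v $ 3) * solid l m v)
    - xy_minus e * (2 * of_nat (2 * l + 1) * xy_plus v * solid l m v)
    - xy_plus e * (2 * of_nat (2 * l + 1) * xy_minus v * solid l m v)"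
    unfolding e by algebra
  also have "\<dots> = of_real ((norm v)\<^sup>2) * solid_lower e l m v + solid_raise e l m v"
    unfolding solid_times_z solid_times_plus solid_times_minus solid_lower_def solid_raise_def
    by (simp add: diff_divide_distrib add_divide_distrib algebra_simps del: solid.simps)
  finally show ?thesis .
qed

lemma solid_lower_Suc:
  "solid_lower e (Suc l) m v = solid l m v * of_real (e $ 3) + of_real (v $ 3) * solid_lower e l m v
    + (xy_plus e * solid l (m - 1) v + xy_plus v * solid_lower e l (m - 1) v)
    + (xy_minus e * solid l (m + 1) v + xy_minus v * solid_lower e l (m + 1) v)"
proof (cases l)
  case (Suc k)
  then show ?thesis
    by (simp add: solid_lower_def algebra_simps)
qed (auto simp: solid_lower_def)

lemma has_vector_derivative_solid:
  "((\<lambda>h. solid l m (v + h *\<^sub>R e)) has_vector_derivative solid_lower e l m (v + h *\<^sub>R e)) (at h)"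
proof (induction l arbitrary: m)
  case 0
  then show ?case by (simp add: solid_lower_def)
next
  case (Suc l)
  have z: "((\<lambda>h. of_real ((v + h *\<^sub>R e) $ 3) :: complex) has_vector_derivative of_real (e $ 3)) (at h)"
    by (auto intro!: derivative_eq_intros simp: has_real_derivative_iff_has_vector_derivative[symmetric])
  have p: "((\<lambda>h. xy_plus (v + h *\<^sub>R e)) has_vector_derivative xy_plus e) (at h)"
    and q: "((\<lambda>h. xy_minus (v + h *\<^sub>R e)) has_vector_derivative xy_minus e) (at h)"
    by (auto intro!: derivative_eq_intros)
  show ?case
    unfolding solid.simps(2)
    by (rule has_vector_derivative_eq_rhs,
        (rule has_vector_derivative_add has_vector_derivative_mult z p q Suc)+,
        simp add: solid_lower_Suc algebra_simps)
qed

section \<open>Laguerre polynomials and their Gamma moments\<close>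

definition laguerre_poly :: "nat \<Rightarrow> real \<Rightarrow> real poly" where
  "laguerre_poly n \<beta> = (\<Sum>k\<le>n. monom ((-1) ^ k * ((real n + \<beta>) gchoose (n - k)) / fact k) k)"

lemma coeff_laguerre_poly:
  "coeff (laguerre_poly n \<beta>) k =
     (if k \<le> n then (-1) ^ k * ((real n + \<beta>) gchoose (n - k)) / fact k else 0)"
  by (simp add: laguerre_poly_def coeff_sum)

lemma laguerre_poly_0 [simp]: "laguerre_poly 0 \<beta> = 1"
  by (simp add: laguerre_poly_def)

lemma pderiv_laguerre_poly:
  "pderiv (laguerre_poly n \<beta>) = laguerre_poly n \<beta> - laguerre_poly n (\<beta> + 1)"
proof (rule poly_eqI)
  fix k
  show "coeff (pderiv (laguerre_poly n \<beta>)) k = coeff (laguerre_poly n \<beta> - laguerre_poly n (\<beta> + 1)) k"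
  proof (cases "k < n")
    case True
    then obtain j where j: "n - k = Suc j" "n - Suc k = j"
      by (metis Suc_diff_Suc)
    have "(real n + (\<beta> + 1)) gchoose Suc j = ((real n + \<beta>) gchoose j) + ((real n + \<beta>) gchoose Suc j)"
      using gbinomial_Suc_Suc[of "real n + \<beta>" j] by (simp add: add.assoc)
    then have "coeff (laguerre_poly n \<beta> - laguerre_poly n (\<beta> + 1)) k = - ((-1) ^ k * ((real n + \<beta>) gchoose j) / fact k)"
      using True by (simp add: coeff_laguerre_poly j diff_divide_distrib[symmetric] algebra_simps)
    moreover have "coeff (pderiv (laguerre_poly n \<beta>)) k =
        real (Suc k) * ((-1) ^ Suc k * ((real n + \<beta>) gchoose j) / fact (Suc k))"
      using True by (simp add: coeff_pderiv coeff_laguerre_poly j)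
    moreover have "real (Suc k) * (x / fact (Suc k)) = x / fact k" for x :: real
      unfolding fact_Suc of_nat_mult by (simp del: of_nat_Suc)
    ultimately show ?thesis
      by simp
  qed (auto simp: coeff_pderiv coeff_laguerre_poly)
qed

text \<open>Divided by \<open>x\<close> and multiplied by \<open>x\<^sup>\<beta> e\<^sup>-\<^sup>x\<close>, this says that differentiating
  \<open>x\<^sup>\<beta> e\<^sup>-\<^sup>x L\<^sub>n\<close> raises \<open>n\<close> and lowers \<open>\<beta>\<close>. The Rodrigues formula is an iteration of it, and it is also what
  produces the factor \<open>L\<^sub>n\<^sub>+\<^sub>1\<close> in the creation operator below.\<close>

lemma laguerre_poly_raise:
  "[:0, 1:] * pderiv (laguerre_poly n \<beta>) + [:\<beta>, -1:] * laguerre_poly n \<beta> =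
     smult (real (Suc n)) (laguerre_poly (Suc n) (\<beta> - 1))"
proof (rule poly_eqI)
  fix k
  define c where "c = real n + \<beta>"
  have c: "real (Suc n) + (\<beta> - 1) = c"
    by (simp add: c_def)
  have step: "(c - real j) * (c gchoose j) = real (Suc j) * (c gchoose Suc j)" for j
    using gbinomial_absorption[of j c] gbinomial_absorb_comp[of c j] by simp
  show "coeff ([:0, 1:] * pderiv (laguerre_poly n \<beta>) + [:\<beta>, -1:] * laguerre_poly n \<beta>) k =
     coeff (smult (real (Suc n)) (laguerre_poly (Suc n) (\<beta> - 1))) k"
  proof (cases k)
    case 0
    then show ?thesis
      using step[of n] by (simp add: coeff_laguerre_poly c c_def[symmetric]) (simp add: c_def)
  next
    case (Suc i)
    consider "i < n" | "i = n" | "n < i" by linarith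
    then show ?thesis
    proof cases
      case 1
      then obtain j where j: "n = i + Suc j"
        using less_iff_Suc_add by auto
      have "(c - real j) * (c gchoose j) = real (Suc j) * (c gchoose Suc j)"
        by (rule step)
      moreover have "c - real j = real i + 1 + \<beta>"
        by (simp add: c_def j)
      ultimately have *: "(real i + 1 + \<beta>) * (c gchoose j) = real (Suc j) * (c gchoose Suc j)"
        by simp
      have c1: "coeff (laguerre_poly n \<beta>) (Suc i) = (-1) ^ Suc i / fact (Suc i) * (c gchoose j)"
        by (simp add: coeff_laguerre_poly j c_def)
      have "coeff (laguerre_poly n \<beta>) i = (-1) ^ i / fact i * (c gchoose Suc j)"
        by (simp add: coeff_laguerre_poly j c_def)
      also have "(-1) ^ i / fact i = - ((-1) ^ Suc i / fact (Suc i) * (real i + 1))"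
        unfolding fact_Suc of_nat_mult by (simp add: add.commute[of 1 "real i"])
      finally have c2: "coeff (laguerre_poly n \<beta>) i = - ((-1) ^ Suc i / fact (Suc i) * (real i + 1)) * (c gchoose Suc j)" .
      have c3: "coeff (laguerre_poly (Suc n) (\<beta> - 1)) (Suc i) = (-1) ^ Suc i / fact (Suc i) * (c gchoose Suc j)"
        unfolding coeff_laguerre_poly c by (simp add: j)
      have "(real i + 1) * X * (c gchoose j) + \<beta> * X * (c gchoose j) + X * (real i + 1) * (c gchoose Suc j) =
          real (Suc n) * X * (c gchoose Suc j)" for X
      proof -
        have "(real i + 1) * X * (c gchoose j) + \<beta> * X * (c gchoose j) + X * (real i + 1) * (c gchoose Suc j) =
           X * ((real i + 1 + \<beta>) * (c gchoose j)) + X * (real i + 1) * (c gchoose Suc j)"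
          by (simp add: algebra_simps)
        then show ?thesis
          unfolding * by (simp add: j algebra_simps)
      qed
      from this[of "(-1) ^ Suc i / fact (Suc i)"] show ?thesis
        unfolding Suc by (simp add: coeff_pderiv c1 c2 c3 mult_ac add_ac del: power_Suc fact_Suc)
    qed (auto simp: coeff_laguerre_poly coeff_pderiv Suc)
  qed
qed

lemma has_real_derivative_powr_exp_laguerre:
  assumes "0 < x"
  shows "((\<lambda>y. y powr \<beta> * exp (- y) * poly (laguerre_poly n \<beta>) y) has_real_derivative
     real (Suc n) * (x powr (\<beta> - 1) * exp (- x) * poly (laguerre_poly (Suc n) (\<beta> - 1)) x)) (at x)"
proof -
  have "poly ([:0, 1:] * pderiv (laguerre_poly n \<beta>) + [:\<beta>, -1:] * laguerre_poly n \<beta>) x =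
     real (Suc n) * poly (laguerre_poly (Suc n) (\<beta> - 1)) x"
    unfolding laguerre_poly_raise by simp
  then have *: "x * poly (pderiv (laguerre_poly n \<beta>)) x + (\<beta> - x) * poly (laguerre_poly n \<beta>) x =
     real (Suc n) * poly (laguerre_poly (Suc n) (\<beta> - 1)) x"
    by (simp add: algebra_simps)
  have p: "x powr \<beta> = x * x powr (\<beta> - 1)"
    using assms by (simp add: powr_diff)
  have "((\<lambda>y. y powr \<beta> * exp (- y) * poly (laguerre_poly n \<beta>) y) has_real_derivative
     x powr (\<beta> - 1) * exp (- x) * (x * poly (pderiv (laguerre_poly n \<beta>)) x + (\<beta> - x) * poly (laguerre_poly n \<beta>) x)) (at x)"
    using assms
    by (auto intro!: derivative_eq_intros poly_DERIV simp: p algebra_simps)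
  then show ?thesis
    unfolding * by (simp add: mult_ac)
qed

lemma rodrigues_powr_exp:
  assumes "0 < x"
  shows "(deriv ^^ k) (\<lambda>y. y powr c * exp (- y)) x =
    fact k * (x powr (c - real k) * exp (- x) * poly (laguerre_poly k (c - real k)) x)"
  using assms
proof (induction k arbitrary: x)
  case (Suc k)
  let ?g = "\<lambda>y. y powr (c - real k) * exp (- y) * poly (laguerre_poly k (c - real k)) y"
  have "(deriv ^^ Suc k) (\<lambda>y. y powr c * exp (- y)) x = deriv (\<lambda>y. fact k * ?g y) x"
    using Suc by (auto intro!: deriv_cong_ev eventually_mono[OF eventually_nhds_in_open[of "{0<..}"]])
  also have "\<dots> = fact k * (real (Suc k) * (x powr (c - real k - 1) * exp (- x) * poly (laguerre_poly (Suc k) (c - real k - 1)) x))"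
    by (intro DERIV_imp_deriv DERIV_cmult has_real_derivative_powr_exp_laguerre Suc.prems)
  finally show ?case
    by (simp add: algebra_simps)
qed simp

lemma laguerre_eq_poly:
  assumes "0 < x"
  shows "laguerre n \<beta> x = poly (laguerre_poly n \<beta>) x"
proof -
  have "laguerre n \<beta> x = x powr - \<beta> * exp x / fact n *
      (fact n * (x powr \<beta> * exp (- x) * poly (laguerre_poly n \<beta>) x))"
    using assms rodrigues_powr_exp[OF assms, of n "real n + \<beta>"]
    by (simp add: laguerre_def laguerre_rodrigues_def)
  then show ?thesis
    using assms by (simp add: powr_minus exp_minus field_simps)
qed

text \<open>Once the upper entries of the binomial coefficients are negated, the coefficient of each power of
  the variable is an instance of Vandermonde's convolution.\<close>

lemma laguerre_poly_connection:
  "laguerre_poly m \<alpha> = (\<Sum>i\<le>m. smult ((-1) ^ (m - i) * ((\<mu> - \<alpha>) gchoose (m - i))) (laguerre_poly i \<mu>))"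
proof (rule poly_eqI)
  fix k
  show "coeff (laguerre_poly m \<alpha>) k =
    coeff (\<Sum>i\<le>m. smult ((-1) ^ (m - i) * ((\<mu> - \<alpha>) gchoose (m - i))) (laguerre_poly i \<mu>)) k"
  proof (cases "k \<le> m")
    case False
    then show ?thesis by (auto simp: coeff_laguerre_poly coeff_sum intro!: sum.neutral[symmetric])
  next
    case True
    then obtain N where m: "m = k + N"
      using le_Suc_ex by blast
    have neg: "(real (k + j) + b) gchoose j = (-1) ^ j * ((- (b + real k + 1)) gchoose j)" for j b
      using gbinomial_minus'[of "b + real k" j] by (simp add: algebra_simps)
    have "(\<Sum>i\<le>m. (-1) ^ (m - i) * ((\<mu> - \<alpha>) gchoose (m - i)) * coeff (laguerre_poly i \<mu>) k) =
      (\<Sum>i=k..m. (-1) ^ (m - i) * ((\<mu> - \<alpha>) gchoose (m - i)) * coeff (laguerre_poly i \<mu>) k)"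
      by (rule sum.mono_neutral_right) (auto simp: coeff_laguerre_poly)
    also have "\<dots> = (\<Sum>j\<le>N. (-1) ^ j * ((\<mu> - \<alpha>) gchoose j) * coeff (laguerre_poly (m - j) \<mu>) k)"
      by (rule sum.reindex_bij_witness[of _ "\<lambda>j. m - j" "\<lambda>i. m - i"]) (auto simp: m)
    also have "\<dots> = (\<Sum>j\<le>N. (-1) ^ (k + N) / fact k * (((\<mu> - \<alpha>) gchoose j) * ((- (\<mu> + real k + 1)) gchoose (N - j))))"
    proof (rule sum.cong[OF refl])
      fix j assume "j \<in> {..N}"
      then have 1: "m - j = k + (N - j)" and 2: "N - j + j = N"
        by (auto simp: m)
      have 3: "(-1) ^ j * (-1) ^ (N - j) = ((-1) ^ N :: real)"
        unfolding power_add[symmetric] using 2 by (simp add: add.commute)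
      show "(-1) ^ j * ((\<mu> - \<alpha>) gchoose j) * coeff (laguerre_poly (m - j) \<mu>) k =
        (-1) ^ (k + N) / fact k * (((\<mu> - \<alpha>) gchoose j) * ((- (\<mu> + real k + 1)) gchoose (N - j)))"
        unfolding 1 coeff_laguerre_poly diff_add_inverse neg power_add 3[symmetric] by simp
    qed
    also have "\<dots> = (-1) ^ (k + N) / fact k * ((\<mu> - \<alpha> + (- (\<mu> + real k + 1))) gchoose N)"
      unfolding sum_distrib_left[symmetric] atMost_atLeast0 gbinomial_Vandermonde ..
    also have "\<mu> - \<alpha> + (- (\<mu> + real k + 1)) = - (\<alpha> + real k + 1)"
      by simp
    also have "(-1) ^ (k + N) / fact k * (\<dots> gchoose N) = coeff (laguerre_poly m \<alpha>) k"
      unfolding m coeff_laguerre_poly diff_add_inverse neg by (simp add: power_add)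
    finally show ?thesis
      by (simp add: coeff_sum)
  qed
qed

text \<open>An \<open>n\<close>-th finite difference of a polynomial of degree \<open>j\<close> in \<open>\<mu>\<close>; each difference lowers the lower
  entry of the binomial coefficient by one. It vanishes for \<open>n > j\<close>, which is the orthogonality of the
  Laguerre polynomials in disguise.\<close>

lemma alternating_binomial_sum:
  "(\<Sum>k\<le>n. (-1) ^ k * real (n choose k) * ((\<mu> + real k + real j) gchoose j)) =
     (if n \<le> j then (-1) ^ n * ((\<mu> + real j) gchoose (j - n)) else 0)"
proof (induction n arbitrary: \<mu>)
  case (Suc n)
  let ?f = "\<lambda>n \<mu>. \<Sum>k\<le>n. (-1) ^ k * real (n choose k) * ((\<mu> + real k + real j) gchoose j)"
  let ?g = "\<lambda>k. (\<mu> + real k + real j) gchoose j"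
  have "?f (Suc n) \<mu> = (\<Sum>k\<le>Suc n. (-1) ^ k * real (n choose k) * ?g k)
      + (\<Sum>k\<le>Suc n. (-1) ^ k * (if k = 0 then 0 else real (n choose (k - 1))) * ?g k)"
    unfolding sum.distrib[symmetric]
  proof (rule sum.cong[OF refl])
    fix k show "(-1) ^ k * real (Suc n choose k) * ?g k = (-1) ^ k * real (n choose k) * ?g k
      + (-1) ^ k * (if k = 0 then 0 else real (n choose (k - 1))) * ?g k"
      by (cases k) (simp_all add: algebra_simps)
  qed
  also have "(\<Sum>k\<le>Suc n. (-1) ^ k * real (n choose k) * ?g k) = ?f n \<mu>"
    by simp
  also have "(\<Sum>k\<le>Suc n. (-1) ^ k * (if k = 0 then 0 else real (n choose (k - 1))) * ?g k) = - ?f n (\<mu> + 1)"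
    unfolding sum.atMost_Suc_shift by (simp add: sum_negf[symmetric] algebra_simps)
  finally have *: "?f (Suc n) \<mu> = ?f n \<mu> - ?f n (\<mu> + 1)" by simp
  show ?case
  proof (cases "Suc n \<le> j")
    case True
    then obtain i where i: "j - n = Suc i" "j - Suc n = i"
      by (metis Suc_diff_Suc Suc_le_eq)
    have "(\<mu> + real j + 1) gchoose Suc i = ((\<mu> + real j) gchoose i) + ((\<mu> + real j) gchoose Suc i)"
      by (rule gbinomial_Suc_Suc)
    moreover have "\<mu> + 1 + real j = \<mu> + real j + 1" by simp
    ultimately show ?thesis
      unfolding * Suc.IH using True by (simp add: i algebra_simps)
  next
    case False
    then show ?thesis unfolding * Suc.IH by (cases "n = j") auto
  qed
qed simp

text \<open>The integral of \<open>x\<^sup>\<mu> e\<^sup>-\<^sup>x p(x)\<close> over the positive half-line for \<open>\<mu> > - 1\<close>, see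
  \<open>gamma_moment_integral\<close>. As a linear functional on polynomials it can be evaluated algebraically.\<close>

definition gamma_moment :: "real \<Rightarrow> real poly \<Rightarrow> real" where
  "gamma_moment \<mu> p = (\<Sum>k\<le>degree p. coeff p k * Gamma (\<mu> + 1 + real k))"

lemma gamma_moment_eq: "degree p \<le> n \<Longrightarrow> gamma_moment \<mu> p = (\<Sum>k\<le>n. coeff p k * Gamma (\<mu> + 1 + real k))"
  unfolding gamma_moment_def by (rule sum.mono_neutral_left) (auto simp: coeff_eq_0)

lemma gamma_moment_add: "gamma_moment \<mu> (p + q) = gamma_moment \<mu> p + gamma_moment \<mu> q"
proof -
  let ?n = "max (degree p) (degree q)"
  have "degree (p + q) \<le> ?n" by (rule degree_add_le_max)
  then show ?thesis
    using gamma_moment_eq[of p ?n \<mu>] gamma_moment_eq[of q ?n \<mu>] gamma_moment_eq[of "p + q" ?n \<mu>]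
    by (simp add: sum.distrib algebra_simps)
qed

lemma gamma_moment_smult: "gamma_moment \<mu> (smult c p) = c * gamma_moment \<mu> p"
  using gamma_moment_eq[of "smult c p" "degree p" \<mu>]
  by (simp add: degree_smult_le gamma_moment_def sum_distrib_left mult_ac)

lemma gamma_moment_sum: "gamma_moment \<mu> (\<Sum>i\<in>A. f i) = (\<Sum>i\<in>A. gamma_moment \<mu> (f i))"
  by (induction A rule: infinite_finite_induct) (simp_all add: gamma_moment_add, simp_all add: gamma_moment_def)

lemma gamma_moment_laguerre_monom:
  assumes "\<mu> > -1"
  shows "gamma_moment \<mu> (laguerre_poly n \<mu> * monom 1 j) =
     (if n \<le> j then (-1) ^ n * Gamma (real n + \<mu> + 1) / fact n * fact j * ((\<mu> + real j) gchoose (j - n)) else 0)"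
proof -
  have nz: "\<mu> + real k + 1 \<notin> \<int>\<^sub>\<le>\<^sub>0" for k
    using assms by (auto elim!: nonpos_Ints_cases)
  have "degree (laguerre_poly n \<mu> * monom 1 j) \<le> n + j"
    by (rule order.trans[OF degree_mult_le] add_mono degree_le)+ 
       (auto simp: coeff_laguerre_poly intro!: degree_le)
  then have "gamma_moment \<mu> (laguerre_poly n \<mu> * monom 1 j) = 
     (\<Sum>k\<le>n + j. coeff (laguerre_poly n \<mu> * monom 1 j) k * Gamma (\<mu> + 1 + real k))"
    by (rule gamma_moment_eq)
  also have "\<dots> = (\<Sum>k=j..n + j. coeff (laguerre_poly n \<mu> * monom 1 j) k * Gamma (\<mu> + 1 + real k))"
    by (rule sum.mono_neutral_right) (auto simp: coeff_monom_mult mult.commute[of _ "monom 1 j"])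
  also have "\<dots> = (\<Sum>k\<le>n. coeff (laguerre_poly n \<mu>) k * Gamma (\<mu> + 1 + real (k + j)))"
    by (rule sum.reindex_bij_witness[of _ "\<lambda>k. k + j" "\<lambda>k. k - j"])
       (auto simp: coeff_monom_mult mult.commute[of _ "monom 1 j"])
  also have "\<dots> = (\<Sum>k\<le>n. Gamma (real n + \<mu> + 1) / fact n * fact j * 
      ((-1) ^ k * real (n choose k) * ((\<mu> + real k + real j) gchoose j)))"
  proof (rule sum.cong[OF refl])
    fix k assume "k \<in> {..n}"
    then have k: "k \<le> n" by simp
    have *: "(a + real i) gchoose i = Gamma (a + real i + 1) / (Gamma (a + 1) * fact i)" if "a + 1 \<notin> \<int>\<^sub>\<le>\<^sub>0" for a i
      using pochhammer_Gamma[OF that, of i] that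
      by (simp add: gbinomial_pochhammer' add_ac Gamma_eq_zero_iff)
    have 1: "(real n + \<mu>) gchoose (n - k) = Gamma (real n + \<mu> + 1) / (Gamma (\<mu> + real k + 1) * fact (n - k))"
      using *[of "\<mu> + real k" "n - k"] nz[of k] k by (simp add: of_nat_diff add_ac)
    have 2: "(\<mu> + real k + real j) gchoose j = Gamma (\<mu> + real k + real j + 1) / (Gamma (\<mu> + real k + 1) * fact j)"
      using *[of "\<mu> + real k" j] nz[of k] by simp
    have 3: "real (n choose k) = fact n / (fact k * fact (n - k))"
      using k by (rule binomial_fact)
    have 4: "\<mu> + 1 + real (k + j) = \<mu> + real k + real j + 1" by simp
    show "coeff (laguerre_poly n \<mu>) k * Gamma (\<mu> + 1 + real (k + j)) = Gamma (real n + \<mu> + 1) / fact n * fact j * 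
      ((-1) ^ k * real (n choose k) * ((\<mu> + real k + real j) gchoose j))"
      unfolding coeff_laguerre_poly 1 2 3 4 using k nz[of k] by (simp add: field_simps)
  qed
  also have "\<dots> = Gamma (real n + \<mu> + 1) / fact n * fact j *
      (if n \<le> j then (-1) ^ n * ((\<mu> + real j) gchoose (j - n)) else 0)"
    unfolding sum_distrib_left[symmetric] alternating_binomial_sum ..
  finally show ?thesis by simp
qed

lemma gamma_moment_laguerre_le:
  assumes "\<mu> > -1" "i \<le> n"
  shows "gamma_moment \<mu> (laguerre_poly n \<mu> * laguerre_poly i \<mu>) =
     (if i = n then Gamma (real n + \<mu> + 1) / fact n else 0)"
proof -
  have "laguerre_poly n \<mu> * laguerre_poly i \<mu> =
    (\<Sum>k\<le>i. smult (coeff (laguerre_poly i \<mu>) k) (laguerre_poly n \<mu> * monom 1 k))"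
    unfolding laguerre_poly_def[of i] sum_distrib_left
    by (rule sum.cong[OF refl])
       (auto simp: coeff_laguerre_poly laguerre_poly_def[of i, symmetric] mult_smult_right[symmetric] smult_monom simp del: mult_smult_right)
  then have "gamma_moment \<mu> (laguerre_poly n \<mu> * laguerre_poly i \<mu>) =
    (\<Sum>k\<le>i. coeff (laguerre_poly i \<mu>) k * gamma_moment \<mu> (laguerre_poly n \<mu> * monom 1 k))"
    by (simp add: gamma_moment_sum gamma_moment_smult)
  also have "\<dots> = (\<Sum>k\<le>i. if k = n then Gamma (real n + \<mu> + 1) / fact n else 0)"
    using assms by (intro sum.cong) (auto simp: gamma_moment_laguerre_monom coeff_laguerre_poly power_mult_distrib[symmetric])
  finally show ?thesis
    using assms by auto
qed

lemma gamma_moment_laguerre: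
  assumes "\<mu> > -1"
  shows "gamma_moment \<mu> (laguerre_poly n \<mu> * laguerre_poly i \<mu>) =
     (if i = n then Gamma (real n + \<mu> + 1) / fact n else 0)"
  using gamma_moment_laguerre_le[OF assms, of i n] gamma_moment_laguerre_le[OF assms, of n i]
  by (cases "i \<le> n") (auto simp: mult.commute)

text \<open>Re-expansion of both factors in the family with parameter \<open>\<mu>\<close> leaves, by orthogonality, a single sum
  over the common index.\<close>

lemma gamma_moment_laguerre_K:
  assumes "\<mu> > -1"
  shows "gamma_moment \<mu> (laguerre_poly m \<alpha> * laguerre_poly n \<kappa>) = K_sum \<mu> \<alpha> \<kappa> m n"
proof -
  let ?A = "\<lambda>i. (-1) ^ (m - i) * ((\<mu> - \<alpha>) gchoose (m - i))"
  let ?B = "\<lambda>i. (-1) ^ (n - i) * ((\<mu> - \<kappa>) gchoose (n - i))"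
  let ?h = "\<lambda>i. Gamma (real i + \<mu> + 1) / fact i"
  have "laguerre_poly m \<alpha> * laguerre_poly n \<kappa> =
     (\<Sum>i\<le>m. \<Sum>j\<le>n. smult (?A i * ?B j) (laguerre_poly i \<mu> * laguerre_poly j \<mu>))"
    by (subst laguerre_poly_connection[of m \<alpha> \<mu>], subst laguerre_poly_connection[of n \<kappa> \<mu>])
       (simp add: sum_product mult_ac)
  then have "gamma_moment \<mu> (laguerre_poly m \<alpha> * laguerre_poly n \<kappa>) =
     (\<Sum>i\<le>m. \<Sum>j\<le>n. ?A i * ?B j * (if j = i then ?h i else 0))"
    by (simp add: gamma_moment_sum gamma_moment_smult gamma_moment_laguerre[OF assms])
  also have "\<dots> = (\<Sum>i\<le>m. if i \<le> n then ?A i * ?B i * ?h i else 0)"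
    by (intro sum.cong refl) (simp add: if_distrib[of "(*) _"] cong: if_cong)
  also have "\<dots> = (\<Sum>i=0..min m n. ?A i * ?B i * ?h i)"
    by (rule sum.mono_neutral_cong_right) auto
  also have "\<dots> = K_sum \<mu> \<alpha> \<kappa> m n"
    unfolding K_sum_def sum_distrib_left
  proof (rule sum.cong[OF refl])
    fix i assume "i \<in> {0..min m n}"
    then have i: "i \<le> m" "i \<le> n" by auto
    have "even ((m - i) + (n - i)) \<longleftrightarrow> even (m + n)"
      using i by auto
    then have s: "(-1) ^ (m - i) * (-1) ^ (n - i) = ((-1) ^ (m + n) :: real)"
      unfolding power_add[symmetric] by (simp add: minus_one_power_iff)
    have nz: "\<mu> + 1 \<notin> \<int>\<^sub>\<le>\<^sub>0"
      using assms by (auto elim!: nonpos_Ints_cases)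
    have h: "?h i = Gamma (\<mu> + 1) * ((real i + \<mu>) gchoose i)"
      using pochhammer_Gamma[OF nz, of i] nz
      by (simp add: gbinomial_pochhammer' add_ac Gamma_eq_zero_iff)
    have "?A i * ?B i * ?h i = ((-1) ^ (m - i) * (-1) ^ (n - i)) * ((\<mu> - \<alpha>) gchoose (m - i)) * ((\<mu> - \<kappa>) gchoose (n - i)) * ?h i"
      by simp
    also have "\<dots> = (- 1) ^ (m + n) * Gamma (\<mu> + 1) *
         ((\<mu> - \<alpha> gchoose m - i) * (\<mu> - \<kappa> gchoose n - i) * (real i + \<mu> gchoose i))"
      unfolding s h by simp
    finally show "?A i * ?B i * ?h i = (- 1) ^ (m + n) * Gamma (\<mu> + 1) *
         ((\<mu> - \<alpha> gchoose m - i) * (\<mu> - \<kappa> gchoose n - i) * (real i + \<mu> gchoose i))" .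
  qed
  finally show ?thesis .
qed

section \<open>Hermite polynomials in the span of the Burnett functions\<close>

text \<open>The Burnett polynomial without its normalizing constant, in a form that is smooth on the whole
  space, the origin and the polar axis included.\<close>

definition burnett_fun :: "nat \<times> int \<times> nat \<Rightarrow> real ^ 3 \<Rightarrow> complex" where
  "burnett_fun = (\<lambda>(l, m, n) v.
     of_real (poly (laguerre_poly n (real l + 1 / 2)) ((norm v)\<^sup>2 / 2)) * solid l m v)"

definition burnett_span :: "nat \<Rightarrow> (real ^ 3 \<Rightarrow> complex) set" where
  "burnett_span N = {f. \<exists>c. f = (\<lambda>v. \<Sum>a\<in>burnett_indices N. c a * burnett_fun a v)}"

lemma burnett_span_add:
  assumes "f \<in> burnett_span N" "g \<in> burnett_span N"
  shows "(\<lambda>v. f v + g v) \<in> burnett_span N"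
proof -
  obtain c d where "f = (\<lambda>v. \<Sum>a\<in>burnett_indices N. c a * burnett_fun a v)"
    "g = (\<lambda>v. \<Sum>a\<in>burnett_indices N. d a * burnett_fun a v)"
    using assms by (auto simp: burnett_span_def)
  then have "(\<lambda>v. f v + g v) = (\<lambda>v. \<Sum>a\<in>burnett_indices N. (c a + d a) * burnett_fun a v)"
    by (simp add: sum.distrib algebra_simps)
  then show ?thesis unfolding burnett_span_def by (auto intro!: exI[of _ "\<lambda>a. c a + d a"])
qed

lemma burnett_span_scale:
  assumes "f \<in> burnett_span N"
  shows "(\<lambda>v. k * f v) \<in> burnett_span N"
proof -
  obtain c where "f = (\<lambda>v. \<Sum>a\<in>burnett_indices N. c a * burnett_fun a v)"
    using assms by (auto simp: burnett_span_def)
  then have "(\<lambda>v. k * f v) = (\<lambda>v. \<Sum>a\<in>burnett_indices N. (k * c a) * burnett_fun a v)"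
    by (simp add: sum_distrib_left algebra_simps)
  then show ?thesis unfolding burnett_span_def by (auto intro!: exI[of _ "\<lambda>a. k * c a"])
qed

lemma burnett_span_0: "(\<lambda>v. 0) \<in> burnett_span N"
  by (auto simp: burnett_span_def intro!: exI[of _ "\<lambda>_. 0"])

lemma burnett_span_sum:
  "(\<And>i. i \<in> A \<Longrightarrow> f i \<in> burnett_span N) \<Longrightarrow> (\<lambda>v. \<Sum>i\<in>A. f i v) \<in> burnett_span N"
  by (induction A rule: infinite_finite_induct) (auto intro: burnett_span_0 burnett_span_add)

lemma burnett_fun_in_span:
  assumes "l + 2 * n = N"
  shows "burnett_fun (l, m, n) \<in> burnett_span N"
proof (cases "\<bar>m\<bar> \<le> int l")
  case True
  then have "(l, m, n) \<in> burnett_indices N"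
    using assms by (simp add: burnett_indices_def)
  then have "burnett_fun (l, m, n) = (\<lambda>v. \<Sum>a\<in>burnett_indices N. (if a = (l, m, n) then 1 else 0) * burnett_fun a v)"
    by (simp add: if_distrib[of "\<lambda>x. x * _"] finite_burnett_indices cong: if_cong)
  then show ?thesis
    unfolding burnett_span_def by (intro CollectI exI[of _ "\<lambda>a. if a = (l, m, n) then 1 else 0"])
next
  case False
  then have "burnett_fun (l, m, n) = (\<lambda>v. 0)"
    by (simp add: burnett_fun_def solid_eq_0 fun_eq_iff)
  then show ?thesis by (simp add: burnett_span_0)
qed

text \<open>The image of \<open>burnett_fun (l, m, n)\<close> under \<open>v \<bullet> e - D\<^sub>e\<close>, where \<open>D\<^sub>e\<close> is the derivative in direction \<open>e\<close>
  (see \<open>has_vector_derivative_burnett_fun\<close>).\<close>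

definition creation :: "real ^ 3 \<Rightarrow> nat \<times> int \<times> nat \<Rightarrow> real ^ 3 \<Rightarrow> complex" where
  "creation e = (\<lambda>(l, m, n) v. (of_real (poly (laguerre_poly n (real l + 3 / 2)) ((norm v)\<^sup>2 / 2)) * solid_raise e l m v
      - 2 * of_nat (Suc n) * of_real (poly (laguerre_poly (Suc n) (real l - 1 / 2)) ((norm v)\<^sup>2 / 2)) * solid_lower e l m v)
     / of_nat (2 * l + 1))"

text \<open>The part with \<open>solid_raise\<close> has indices \<open>(l + 1, n)\<close>, the part with \<open>solid_lower\<close> has indices
  \<open>(l - 1, n + 1)\<close>: both have weight \<open>l + 2 n + 1\<close>. For \<open>l = 0\<close> the second part is zero.\<close>

lemma creation_in_span:
  assumes "a \<in> burnett_indices N"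
  shows "creation e a \<in> burnett_span (Suc N)"
proof -
  obtain l m n where a: "a = (l, m, n)"
    by (metis surj_pair)
  then have N: "l + 2 * n = N"
    using assms by (simp add: burnett_indices_def)
  let ?bt = "\<lambda>l m n v. burnett_fun (l, m, n) v"
  let ?r = "1 / (of_nat (2 * l + 1) * of_nat (Suc l)) :: complex"
  let ?s = "- 2 * of_nat (Suc n) * of_nat l / of_nat (2 * l + 1) :: complex"
  have up: "?bt (Suc l) m' n \<in> burnett_span (Suc N)" for m'
    using N by (intro burnett_fun_in_span) simp
  have down: "(\<lambda>v. ?s * ?bt (l - 1) m' (Suc n) v) \<in> burnett_span (Suc N)" for m'
  proof (cases "l = 0")
    case True
    then show ?thesis by (simp add: burnett_span_0)
  next
    case False
    then show ?thesis
      using N by (intro burnett_span_scale burnett_fun_in_span) simp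
  qed
  have lag: "?s * ?bt (l - 1) m' (Suc n) v = ?s * (of_real (poly (laguerre_poly (Suc n) (real l - 1 / 2)) ((norm v)\<^sup>2 / 2)) * solid (l - 1) m' v)" for m' v
    by (cases l) (simp_all add: burnett_fun_def add_ac)
  have lag': "?bt (Suc l) m' n v = of_real (poly (laguerre_poly n (real l + 3 / 2)) ((norm v)\<^sup>2 / 2)) * solid (Suc l) m' v" for m' v
    by (simp add: burnett_fun_def add_ac del: solid.simps)
  have "creation e a = (\<lambda>v.
      (?r * of_int ((int l + 1)\<^sup>2 - m\<^sup>2) * of_real (e $ 3)) * ?bt (Suc l) m n v
    + (- ?r * of_int ((int l + 1 - m) * (int l + 2 - m)) * xy_plus e) * ?bt (Suc l) (m - 1) n v
    + (- ?r * of_int ((m + 1 + int l) * (m + 2 + int l)) * xy_minus e) * ?bt (Suc l) (m + 1) n v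
    + of_real (e $ 3) * (?s * ?bt (l - 1) m (Suc n) v)
    + xy_plus e * (?s * ?bt (l - 1) (m - 1) (Suc n) v)
    + xy_minus e * (?s * ?bt (l - 1) (m + 1) (Suc n) v))"
    unfolding creation_def a lag lag' solid_raise_def solid_lower_def prod.case
    by (rule ext) (simp add: algebra_simps add_divide_distrib diff_divide_distrib del: solid.simps of_nat_Suc of_nat_mult of_nat_add)
  also have "\<dots> \<in> burnett_span (Suc N)"
    by (intro burnett_span_add burnett_span_scale up down)
  finally show ?thesis .
qed

text \<open>By the product rule the derivative is \<open>L' (e \<bullet> v) S + L D\<^sub>e S\<close>. Splitting \<open>(e \<bullet> v) S\<close> with
  \<open>inner_times_solid\<close> and replacing \<open>L'\<close> through \<open>pderiv_laguerre_poly\<close> leaves, in front of \<open>D\<^sub>e S\<close>, the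
  combination that \<open>laguerre_poly_raise\<close> evaluates.\<close>

lemma has_vector_derivative_burnett_fun:
  "((\<lambda>h. burnett_fun a (v + h *\<^sub>R e)) has_vector_derivative
     of_real (e \<bullet> v) * burnett_fun a v - creation e a v) (at 0)"
proof -
  obtain l m n where a: "a = (l, m, n)"
    by (metis surj_pair)
  define \<beta> where "\<beta> = real l + 1 / 2"
  define \<rho> where "\<rho> = (norm v)\<^sup>2 / 2"
  define L where "L = laguerre_poly n \<beta>"
  define c :: complex where "c = of_nat (2 * l + 1)"
  have c: "c \<noteq> 0" "of_real (2 * \<beta>) = c"
    unfolding c_def by (simp add: of_nat_neq_0 del: of_nat_Suc of_nat_add of_nat_mult, simp add: \<beta>_def)
  have \<beta>: "real l + 3 / 2 = \<beta> + 1" "real l - 1 / 2 = \<beta> - 1"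
    by (simp_all add: \<beta>_def)
  have rho: "(norm (v + h *\<^sub>R e))\<^sup>2 / 2 = \<rho> + h * (e \<bullet> v) + h\<^sup>2 * (norm e)\<^sup>2 / 2" for h
  proof -
    have "(norm (v + h *\<^sub>R e))\<^sup>2 = (norm v)\<^sup>2 + 2 * (h * (e \<bullet> v)) + h\<^sup>2 * (norm e)\<^sup>2"
      unfolding power2_norm_eq_inner
      by (simp add: inner_left_distrib inner_right_distrib inner_commute[of v e] power2_eq_square algebra_simps del: dot_square_norm)
    then show ?thesis by (simp add: \<rho>_def)
  qed
  have "((\<lambda>h. (norm (v + h *\<^sub>R e))\<^sup>2 / 2) has_real_derivative e \<bullet> v) (at 0)"
    unfolding rho by (auto intro!: derivative_eq_intros)
  then have "((\<lambda>h. poly L ((norm (v + h *\<^sub>R e))\<^sup>2 / 2)) has_real_derivative poly (pderiv L) \<rho> * (e \<bullet> v)) (at 0)"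
    using DERIV_chain2[where f = "poly L" and g = "\<lambda>h. (norm (v + h *\<^sub>R e))\<^sup>2 / 2" and x = 0, OF poly_DERIV] by (simp add: \<rho>_def)
  then have 1: "((\<lambda>h. of_real (poly L ((norm (v + h *\<^sub>R e))\<^sup>2 / 2)) :: complex) has_vector_derivative
      of_real (poly (pderiv L) \<rho> * (e \<bullet> v))) (at 0)"
    by (intro has_vector_derivative_of_real) (simp add: has_real_derivative_iff_has_vector_derivative)
  have 2: "((\<lambda>h. solid l m (v + h *\<^sub>R e)) has_vector_derivative solid_lower e l m v) (at 0)"
    using has_vector_derivative_solid[of l m v e 0] by simp
  let ?D = "of_real (poly L \<rho>) * solid_lower e l m v + of_real (poly (pderiv L) \<rho> * (e \<bullet> v)) * solid l m v"
  have "((\<lambda>h. burnett_fun a (v + h *\<^sub>R e)) has_vector_derivative ?D) (at 0)"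
    using has_vector_derivative_mult[OF 1 2]
    by (simp add: burnett_fun_def a \<beta>_def[symmetric] L_def[symmetric] \<rho>_def[symmetric])
  moreover have "?D = of_real (e \<bullet> v) * burnett_fun a v - creation e a v"
  proof -
    have p1: "poly (pderiv L) \<rho> = poly L \<rho> - poly (laguerre_poly n (\<beta> + 1)) \<rho>"
      unfolding L_def pderiv_laguerre_poly by simp
    have "poly ([:0, 1:] * pderiv L + [:\<beta>, -1:] * L) \<rho> = real (Suc n) * poly (laguerre_poly (Suc n) (\<beta> - 1)) \<rho>"
      unfolding L_def laguerre_poly_raise by simp
    then have "2 * real (Suc n) * poly (laguerre_poly (Suc n) (\<beta> - 1)) \<rho> =
        2 * \<beta> * poly L \<rho> - 2 * \<rho> * poly (laguerre_poly n (\<beta> + 1)) \<rho>"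
      by (simp add: p1 algebra_simps)
    then have p2: "2 * of_nat (Suc n) * complex_of_real (poly (laguerre_poly (Suc n) (\<beta> - 1)) \<rho>) =
        c * of_real (poly L \<rho>) - of_real (2 * \<rho>) * of_real (poly (laguerre_poly n (\<beta> + 1)) \<rho>)"
      unfolding c(2)[symmetric] by (metis of_real_diff of_real_mult of_real_numeral of_real_of_nat_eq)
    have S: "c * of_real (e \<bullet> v) * solid l m v = of_real (2 * \<rho>) * solid_lower e l m v + solid_raise e l m v"
      using inner_times_solid[of l e v m] by (simp add: c_def \<rho>_def)
    have "c * (of_real (e \<bullet> v) * burnett_fun a v - creation e a v) =
       c * of_real (e \<bullet> v) * solid l m v * of_real (poly L \<rho>)
       - (of_real (poly (laguerre_poly n (\<beta> + 1)) \<rho>) * solid_raise e l m v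
      - 2 * of_nat (Suc n) * of_real (poly (laguerre_poly (Suc n) (\<beta> - 1)) \<rho>) * solid_lower e l m v)"
      unfolding creation_def burnett_fun_def a prod.case \<beta> \<beta>_def[symmetric] \<rho>_def[symmetric] L_def[symmetric] c_def[symmetric]
      using c(1) by (simp add: field_simps)
    also have "\<dots> = c * of_real (e \<bullet> v) * solid l m v * of_real (poly (pderiv L) \<rho>) + c * of_real (poly L \<rho>) * solid_lower e l m v"
      unfolding p2 using S unfolding p1 of_real_diff by algebra
    also have "\<dots> = c * ?D"
      by (simp add: algebra_simps)
    finally show ?thesis
      using c(1) by simp
  qed
  ultimately show ?thesis by simp
qed

lemma maxwellian_pos: "maxwellian v > 0"
  by (simp add: maxwellian_def)

lemma has_vector_derivative_maxwellian:
  "((\<lambda>h. of_real (maxwellian (v + h *\<^sub>R e)) :: complex) has_vector_derivative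
     of_real (- (e \<bullet> v) * maxwellian v)) (at 0)"
proof -
  have "((\<lambda>h. maxwellian (v + h *\<^sub>R e)) has_real_derivative - (e \<bullet> v) * maxwellian v) (at 0)"
    unfolding maxwellian_def power2_norm_eq_inner
    by (auto intro!: derivative_eq_intros simp: inner_commute algebra_simps)
  then show ?thesis
    by (intro has_vector_derivative_of_real) (simp add: has_real_derivative_iff_has_vector_derivative)
qed

text \<open>Differentiating \<open>M g\<close> gives \<open>M (\<partial>\<^sub>i g - v\<^sub>i g)\<close>, and \<open>v\<^sub>i - \<partial>\<^sub>i\<close> raises the weight of \<open>g\<close> by one.\<close>

lemma partial_deriv_maxwellian_span:
  assumes "g \<in> burnett_span N" and "\<And>v. complex_of_real (f v) = of_real (maxwellian v) * g v"
  shows "\<exists>g'\<in>burnett_span (Suc N). \<forall>v. complex_of_real (partial_deriv i f v) = of_real (maxwellian v) * g' v"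
proof -
  let ?e = "axis i 1 :: real ^ 3"
  obtain c where g: "g = (\<lambda>v. \<Sum>a\<in>burnett_indices N. c a * burnett_fun a v)"
    using assms(1) by (auto simp: burnett_span_def)
  define g' where "g' = (\<lambda>v. \<Sum>a\<in>burnett_indices N. - c a * creation ?e a v)"
  have "g' \<in> burnett_span (Suc N)"
    unfolding g'_def by (intro burnett_span_sum burnett_span_scale creation_in_span)
  moreover have "complex_of_real (partial_deriv i f v) = of_real (maxwellian v) * g' v" for v
  proof -
    have "((\<lambda>h. g (v + h *\<^sub>R ?e)) has_vector_derivative
        (\<Sum>a\<in>burnett_indices N. c a * (of_real (?e \<bullet> v) * burnett_fun a v - creation ?e a v))) (at 0)"
      unfolding g
      by (intro has_vector_derivative_sum has_vector_derivative_mult_right has_vector_derivative_burnett_fun)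
    then have "((\<lambda>h. g (v + h *\<^sub>R ?e)) has_vector_derivative of_real (?e \<bullet> v) * g v + g' v) (at 0)"
      by (simp add: g g'_def sum_distrib_left sum_subtractf sum_negf algebra_simps)
    from has_vector_derivative_mult[OF has_vector_derivative_maxwellian[of v ?e] this]
    have "((\<lambda>h. complex_of_real (f (v + h *\<^sub>R ?e))) has_vector_derivative of_real (maxwellian v) * g' v) (at 0)"
      unfolding assms(2) by (simp add: algebra_simps)
    note D = this
    have "((\<lambda>h. Re (complex_of_real (f (v + h *\<^sub>R ?e)))) has_vector_derivative Re (of_real (maxwellian v) * g' v)) (at 0)"
      by (rule bounded_linear.has_vector_derivative[OF bounded_linear_Re D])
    then have R: "((\<lambda>h. f (v + h *\<^sub>R ?e)) has_real_derivative Re (of_real (maxwellian v) * g' v)) (at 0)"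
      by (simp add: has_real_derivative_iff_has_vector_derivative)
    then have "((\<lambda>h. complex_of_real (f (v + h *\<^sub>R ?e))) has_vector_derivative of_real (Re (of_real (maxwellian v) * g' v))) (at 0)"
      by (intro has_vector_derivative_of_real) (simp add: has_real_derivative_iff_has_vector_derivative)
    \<comment> \<open>The derivative of a real-valued function is real, so no imaginary part was dropped.\<close>
    then have "of_real (Re (of_real (maxwellian v) * g' v)) = of_real (maxwellian v) * g' v"
      using D by (rule vector_derivative_unique_at)
    then show ?thesis
      using DERIV_imp_deriv[OF R] by (simp add: partial_deriv_def)
  qed
  ultimately show ?thesis by blast
qed

lemma partial_deriv_funpow_maxwellian_span:
  assumes "\<exists>g\<in>burnett_span N. \<forall>v. complex_of_real (f v) = of_real (maxwellian v) * g v"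
  shows "\<exists>g\<in>burnett_span (k + N). \<forall>v. complex_of_real ((partial_deriv i ^^ k) f v) = of_real (maxwellian v) * g v"
proof (induction k)
  case (Suc k)
  then show ?case
    using partial_deriv_maxwellian_span[of _ "k + N" "(partial_deriv i ^^ k) f" i] by auto
qed (use assms in auto)

text \<open>The derivatives in the definition of the Hermite polynomial are applied one after the other to
  \<open>M\<close>, which is \<open>M\<close> times the Burnett function of weight \<open>0\<close>.\<close>

theorem hermite_in_burnett_span: "(\<lambda>v. complex_of_real (hermite \<alpha> v)) \<in> burnett_span (msize \<alpha>)"
proof -
  define f where "f = (partial_deriv 1 ^^ (\<alpha> $ 1)) ((partial_deriv 2 ^^ (\<alpha> $ 2))
       ((partial_deriv 3 ^^ (\<alpha> $ 3)) maxwellian))"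
  have "(\<lambda>v. burnett_fun (0, 0, 0) v) \<in> burnett_span 0"
    by (intro burnett_fun_in_span) simp
  then have "\<exists>g\<in>burnett_span 0. \<forall>v. complex_of_real (maxwellian v) = of_real (maxwellian v) * g v"
    by (rule bexI[rotated]) (simp add: burnett_fun_def)
  then have "\<exists>g\<in>burnett_span (\<alpha> $ 1 + (\<alpha> $ 2 + (\<alpha> $ 3 + 0))). \<forall>v. complex_of_real (f v) = of_real (maxwellian v) * g v"
    unfolding f_def by (intro partial_deriv_funpow_maxwellian_span)
  then obtain g where g: "g \<in> burnett_span (msize \<alpha>)" "\<And>v. complex_of_real (f v) = of_real (maxwellian v) * g v"
    by (auto simp: msize_def add_ac)
  have "complex_of_real (hermite \<alpha> v) = (-1) ^ msize \<alpha> * g v" for v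
  proof -
    have "complex_of_real (hermite \<alpha> v) = (-1) ^ msize \<alpha> / of_real (maxwellian v) * of_real (f v)"
      by (simp add: hermite_def f_def)
    then show ?thesis
      using maxwellian_pos[of v] unfolding g(2) by simp
  qed
  then show ?thesis
    using burnett_span_scale[OF g(1)] by simp
qed

section \<open>Spherical and solid harmonics\<close>

text \<open>The polynomial factor of the associated Legendre function \<open>P\<^sub>l\<^sup>m\<close>, scaled to be the coefficient of \<open>u\<^sup>m\<close>
  in \<open>(x + u / 2 + (x\<^sup>2 - 1) / (2 u))\<^sup>l\<close>, i.e. the Taylor coefficient of order \<open>l + m\<close> of
  \<open>((x + u)\<^sup>2 - 1)\<^sup>l / 2\<^sup>l\<close> in \<open>u\<close>. In this scaling both signs of \<open>m\<close> are on the same footing.\<close>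

definition legendre_poly :: "nat \<Rightarrow> int \<Rightarrow> real poly" where
  "legendre_poly l m = (if int l + m < 0 then 0
     else smult (1 / (fact (nat (int l + m)) * 2 ^ l)) ((pderiv ^^ nat (int l + m)) ([:-1, 0, 1:] ^ l)))"

text \<open>Leibniz' rule, where only the first three derivatives of the quadratic factor survive. The truncated
  subtractions in \<open>k - 1\<close> and \<open>k - 2\<close> are harmless because the factors in front vanish.\<close>

lemma higher_pderiv_times_quadratic:
  fixes f :: "real poly"
  shows "(pderiv ^^ k) ([:-1, 0, 1:] * f) = [:-1, 0, 1:] * (pderiv ^^ k) f +
     smult (2 * real k) ([:0, 1:] * (pderiv ^^ (k - 1)) f) + smult (real k * (real k - 1)) ((pderiv ^^ (k - 2)) f)"
proof (induction k)
  case (Suc k)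
  have q: "pderiv [:-1, 0, 1:] = smult 2 [:0, 1 :: real:]" "pderiv [:0, 1 :: real:] = 1"
    by (simp_all add: pderiv_pCons)
  consider "k = 0" | "k = 1" | i where "k = Suc (Suc i)"
    by (metis One_nat_def old.nat.exhaust)
  then show ?case
  proof cases
    case 1
    then show ?thesis
      by (simp add: pderiv_mult q del: mult_pCons_left mult_pCons_right) (rule poly_ext, simp)
  next
    case 2
    then show ?thesis 
      by (simp add: pderiv_mult pderiv_add q pderiv_smult del: mult_pCons_left mult_pCons_right)
         (rule poly_ext, simp add: pderiv_pCons algebra_simps)
  next
    case 3
    define g where "g = (pderiv ^^ i) f"
    have "(pderiv ^^ Suc k) ([:-1, 0, 1:] * f) = pderiv ([:-1, 0, 1:] * (pderiv ^^ k) f +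
     smult (2 * real k) ([:0, 1:] * (pderiv ^^ (k - 1)) f) + smult (real k * (real k - 1)) ((pderiv ^^ (k - 2)) f))"
      using Suc by simp
    also have "\<dots> = [:-1, 0, 1:] * pderiv (pderiv (pderiv g)) + smult 2 [:0, 1:] * pderiv (pderiv g)
       + smult (2 * real k) ([:0, 1:] * pderiv (pderiv g) + pderiv g) + smult (real k * (real k - 1)) (pderiv g)"
      unfolding pderiv_add pderiv_mult pderiv_smult q 3 g_def by (simp add: algebra_simps)
    also have "\<dots> = [:-1, 0, 1:] * pderiv (pderiv (pderiv g)) + smult (2 * (real k + 1)) ([:0, 1:] * pderiv (pderiv g))
       + smult ((real k + 1) * real k) (pderiv g)"
      by (rule poly_ext) (simp add: algebra_simps)
    finally show ?thesis
      by (simp add: 3 g_def)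
  qed
qed simp

text \<open>The recursion of Laurent coefficients that also defines \<open>solid\<close>.\<close>

lemma legendre_poly_Suc:
  "legendre_poly (Suc l) m = [:0, 1:] * legendre_poly l m + smult (1 / 2) (legendre_poly l (m - 1))
     + smult (1 / 2) ([:-1, 0, 1:] * legendre_poly l (m + 1))"
proof -
  define u where "u = ([:-1, 0, 1:] :: real poly) ^ l"
  have u: "[:-1, 0, 1:] ^ Suc l = [:-1, 0, 1:] * u"
    by (simp add: u_def)
  have D: "legendre_poly l (int k - int l) = smult (1 / (fact k * 2 ^ l)) ((pderiv ^^ k) u)" for k
    by (simp add: legendre_poly_def u_def)
  show ?thesis
  proof (cases "int l + m + 1 < 0")
    case True
    then show ?thesis by (simp add: legendre_poly_def)
  next
    case False
    then obtain k where k: "int l + m + 1 = int k"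
      by (metis nonneg_int_cases not_less)
    have m: "m + 1 = int k - int l" "m = int k - 1 - int l" "m - 1 = int k - 2 - int l"
      using k by auto
    have L: "legendre_poly (Suc l) m = smult (1 / (fact k * 2 ^ Suc l)) ((pderiv ^^ k) ([:-1, 0, 1:] * u))"
      using k unfolding legendre_poly_def u by (simp add: add_ac)
    have 1: "legendre_poly l m = smult (real k / (fact k * 2 ^ l)) ((pderiv ^^ (k - 1)) u)"
    proof (cases k)
      case 0
      then show ?thesis using m by (simp add: legendre_poly_def)
    next
      case (Suc j)
      then have "m = int j - int l" using m by simp
      then show ?thesis using D[of j] by (simp add: Suc del: of_nat_Suc)
    qed
    have 2: "legendre_poly l (m - 1) = smult (real k * (real k - 1) / (fact k * 2 ^ l)) ((pderiv ^^ (k - 2)) u)"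
    proof (cases "k < 2")
      case True
      then have "k = 0 \<or> k = 1" by auto
      then show ?thesis using m by (auto simp: legendre_poly_def)
    next
      case False
      then obtain j where j: "k = Suc (Suc j)"
        by (metis One_nat_def less_2_cases_iff old.nat.exhaust)
      then have "m - 1 = int j - int l" using m by simp
      moreover have "real k * (real k - 1) / (fact k * 2 ^ l) = 1 / (fact j * 2 ^ l)"
        by (simp add: j divide_simps) (simp add: algebra_simps)?
      ultimately show ?thesis using D[of j] by (simp add: j)
    qed
    show ?thesis
      unfolding L 1 2 unfolding m(1) D higher_pderiv_times_quadratic
      by (rule poly_ext) (simp add: field_simps)
  qed
qed

lemma higher_pderiv_quadratic_power:
  assumes "a \<le> l"
  shows "\<exists>q. (pderiv ^^ a) ([:-1, 0, 1 :: real:] ^ l) = [:-1, 0, 1:] ^ (l - a) * q"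
  using assms
proof (induction a)
  case (Suc a)
  then obtain q where q: "(pderiv ^^ a) ([:-1, 0, 1 :: real:] ^ l) = [:-1, 0, 1:] ^ (l - a) * q"
    by auto
  obtain k where k: "l - a = Suc k" "l - Suc a = k"
    using Suc.prems by (metis Suc_diff_Suc Suc_le_eq)
  let ?w = "[:-1, 0, 1 :: real:]"
  have "(pderiv ^^ Suc a) (?w ^ l) = ?w ^ k * (?w * pderiv q + smult (real (Suc k)) (pderiv ?w * q))"
    unfolding funpow.simps comp_def q k pderiv_mult pderiv_power_Suc
    by (simp add: algebra_simps del: mult_pCons_left mult_pCons_right)
  then show ?case unfolding k by blast
qed auto

lemma higher_pderiv_quadratic_power_zero:
  assumes "a < l" "x\<^sup>2 = 1"
  shows "poly ((pderiv ^^ a) ([:-1, 0, 1 :: real:] ^ l)) x = 0"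
proof -
  obtain q where "(pderiv ^^ a) ([:-1, 0, 1 :: real:] ^ l) = [:-1, 0, 1:] ^ (l - a) * q"
    using higher_pderiv_quadratic_power[of a l] assms by auto
  then show ?thesis using assms by (simp add: power2_eq_square)
qed

lemma sphere_coords: "norm (v :: real ^ 3) = 1 \<Longrightarrow> (v $ 1)\<^sup>2 + (v $ 2)\<^sup>2 + (v $ 3)\<^sup>2 = 1"
  by (simp add: norm_vec_def L2_set_def sum_3)

text \<open>Substituting \<open>w = \<zeta> u\<close> turns one Laurent polynomial into the other: \<open>a = \<zeta> / 2\<close>, and
  \<open>b \<zeta> = (z\<^sup>2 - 1) / 2\<close> on the unit sphere.\<close>

lemma solid_eq_legendre:
  assumes "norm v = 1" "\<zeta> = \<i> * Complex (v $ 1) (v $ 2)" "\<zeta> \<noteq> 0"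
  shows "solid l m v = \<zeta> powi m * of_real (poly (legendre_poly l m) (v $ 3))"
proof (induction l arbitrary: m)
  case 0
  have "(pderiv ^^ Suc k) (1 :: real poly) = 0" for k
    by (simp only: funpow_Suc_right comp_def pderiv_1 higher_pderiv_0)
  then have "legendre_poly 0 m = 0" if "m > 0"
    using that by (cases "nat m") (auto simp: legendre_poly_def)
  moreover have "legendre_poly 0 m = 0" if "m < 0"
    using that by (simp add: legendre_poly_def)
  ultimately show ?case
    by (cases m "0 :: int" rule: linorder_cases) (simp_all add: legendre_poly_def)
next
  case (Suc l)
  have a: "xy_plus v = \<zeta> / 2"
    by (simp add: xy_plus_def assms(2))
  have "(v $ 1)\<^sup>2 + (v $ 2)\<^sup>2 = 1 - (v $ 3)\<^sup>2"
    using sphere_coords[OF assms(1)] by simp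
  then have b: "xy_minus v * \<zeta> = of_real ((v $ 3)\<^sup>2 - 1) / 2"
    by (simp add: xy_minus_def assms(2) complex_eq_iff power2_eq_square field_simps)
  have m: "\<zeta> * \<zeta> powi (m - 1) = \<zeta> powi m" "\<zeta> powi (m + 1) = \<zeta> * \<zeta> powi m"
    using assms(3) power_int_add_1'[of \<zeta> "m - 1"] power_int_add_1'[of \<zeta> m] by simp_all
  have "solid (Suc l) m v = \<zeta> powi m * (of_real (v $ 3 * poly (legendre_poly l m) (v $ 3)))
     + (\<zeta> * \<zeta> powi (m - 1)) * (of_real (poly (legendre_poly l (m - 1)) (v $ 3) / 2))
     + (xy_minus v * \<zeta>) * \<zeta> powi m * of_real (poly (legendre_poly l (m + 1)) (v $ 3))"
    by (simp add: Suc a m(2))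
  also have "\<dots> = \<zeta> powi m * of_real (poly (legendre_poly (Suc l) m) (v $ 3))"
    unfolding m(1) b legendre_poly_Suc by (simp add: field_simps power2_eq_square)
  finally show ?case .
qed

lemma solid_axis: "v $ 1 = 0 \<Longrightarrow> v $ 2 = 0 \<Longrightarrow> solid l m v = (if m = 0 then of_real (v $ 3) ^ l else 0)"
proof (induction l arbitrary: m)
  case (Suc l)
  then have "xy_plus v = 0" "xy_minus v = 0"
    by (simp_all add: xy_plus_def xy_minus_def complex_eq_iff)
  then show ?case using Suc by simp
qed simp

lemma legendre_poly_pole:
  assumes "x\<^sup>2 = 1"
  shows "poly (legendre_poly l 0) x = x ^ l"
proof (induction l)
  case (Suc l)
  have "poly (legendre_poly l (- 1)) x = 0"
    using higher_pderiv_quadratic_power_zero[of "l - 1" l x] assms by (cases l) (simp_all add: legendre_poly_def)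
  then show ?case
    using assms by (simp add: legendre_poly_Suc Suc power2_eq_square)
qed (simp add: legendre_poly_def)

definition sph_norm :: "nat \<Rightarrow> int \<Rightarrow> complex" where
  "sph_norm l m = of_real (sqrt ((2 * real l + 1) / (4 * pi) * (fact (nat (int l - m)) / fact (nat (int l + m))))
     * fact (nat (int l + m)) / fact l) * \<i> powi m"

lemma deriv_funpow_poly: "(deriv ^^ k) (poly p) = poly ((pderiv ^^ k) p)"
proof (induction k)
  case (Suc k)
  have "deriv (poly q) = poly (pderiv q)" for q :: "'a poly"
    by (rule ext) (intro DERIV_imp_deriv poly_DERIV)
  then show ?case by (simp add: Suc)
qed simp

lemma assoc_legendre_eq:
  assumes "0 \<le> int l + m"
  shows "assoc_legendre l m x =
    (- 1) powi m * sqrt (1 - x\<^sup>2) powi m * (fact (nat (int l + m)) / fact l) * poly (legendre_poly l m) x"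
proof -
  have "(\<lambda>y. (y\<^sup>2 - 1) ^ l) = poly ([:-1, 0, 1 :: real:] ^ l)"
    by (rule ext) (simp add: power2_eq_square)
  then show ?thesis
    using assms by (simp add: assoc_legendre_def deriv_funpow_poly legendre_poly_def mult_ac)
qed

text \<open>Away from the poles both sides are powers of \<open>x + \<i> y\<close> times the same polynomial in \<open>z\<close>. At the poles
  both vanish if \<open>m \<noteq> 0\<close>, and for \<open>m = 0\<close> both reduce to \<open>z\<^sup>l\<close> up to the constant.\<close>

lemma sph_harm_eq_solid:
  assumes v: "norm v = 1" and m: "\<bar>m\<bar> \<le> int l"
  shows "sph_harm l m v = sph_norm l m * solid l m v"
proof -
  define w where "w = Complex (v $ 1) (v $ 2)"
  define P where "P = poly (legendre_poly l m) (v $ 3)"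
  have sq: "(v $ 1)\<^sup>2 + (v $ 2)\<^sup>2 = 1 - (v $ 3)\<^sup>2"
    using sphere_coords[OF v] by simp
  then have w: "sqrt (1 - (v $ 3)\<^sup>2) = norm w"
    by (simp add: w_def cmod_def)
  have "\<bar>v $ 3\<bar> \<le> 1"
    using component_le_norm_cart[of v 3] v by simp
  then have cos: "cos (arccos (v $ 3)) = v $ 3"
    by (simp add: cos_arccos)
  have "exp (\<i> * of_int m * of_real (Arg w)) = cis (Arg w) powi m"
    by (simp add: cis_power_int) (simp add: cis_conv_exp mult_ac)
  then have sph: "sph_harm l m v = of_real (sqrt ((2 * real l + 1) / (4 * pi) * (fact (nat (int l - m)) / fact (nat (int l + m))))
     * (fact (nat (int l + m)) / fact l)) * ((- 1) powi m * of_real (norm w) powi m * of_real P * cis (Arg w) powi m)"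
    using m unfolding sph_harm_def sph_harm_angle_def cos w_def[symmetric]
    by (simp add: assoc_legendre_eq w P_def mult_ac)
  have i: "(- 1) powi m = \<i> powi m * \<i> powi m"
    by (simp add: power_int_mult_distrib[symmetric])
  have "(- 1) powi m * of_real (norm w) powi m * of_real P * cis (Arg w) powi m = \<i> powi m * solid l m v"
  proof (cases "w = 0")
    case False
    have "of_real (norm w) * cis (Arg w) = w"
      by (metis rcis_cmod_Arg rcis_def)
    then have "(of_real (norm w) * cis (Arg w)) powi m = w powi m" by simp
    moreover have "solid l m v = (\<i> * w) powi m * of_real P"
      unfolding P_def using v False by (intro solid_eq_legendre) (auto simp: w_def)
    ultimately show ?thesis
      unfolding i by (simp add: power_int_mult_distrib mult_ac)
  next
    case True
    then have v12: "v $ 1 = 0" "v $ 2 = 0" by (simp_all add: w_def complex_eq_iff)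
    show ?thesis
    proof (cases "m = 0")
      case True
      have "(v $ 3)\<^sup>2 = 1" using sq v12 by simp
      then show ?thesis
        using True by (simp add: solid_axis[OF v12] P_def legendre_poly_pole)
    next
      case False
      then show ?thesis
        using True by (simp add: solid_axis[OF v12] power_int_0_left_if)
    qed
  qed
  then show ?thesis
    unfolding sph sph_norm_def by simp
qed

text \<open>Conjugation exchanges \<open>a\<close> with \<open>- b\<close>, which amounts to replacing \<open>u\<close> by \<open>- 1 / u\<close>.\<close>

lemma cnj_solid: "cnj (solid l m v) = (- 1) powi m * solid l (- m) v"
proof (induction l arbitrary: m)
  case (Suc l)
  have c: "cnj (xy_plus v) = - xy_minus v" "cnj (xy_minus v) = - xy_plus v"
    by (simp_all add: xy_plus_def xy_minus_def complex_eq_iff)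
  have p: "(-1 :: complex) powi (m - 1) = - ((-1) powi m)" "(-1 :: complex) powi (m + 1) = - ((-1) powi m)"
    by (simp_all add: power_int_diff power_int_add)
  have "- (m - 1) = - m + 1" "- (m + 1) = - m - 1" by simp_all
  then show ?case
    by (simp add: Suc c p) (simp add: algebra_simps)
qed simp

text \<open>The integral of \<open>p\<close> over \<open>[- 1, 1]\<close>, written in the variable \<open>\<theta>\<close> in which it arises on the sphere.\<close>

definition legendre_int :: "real poly \<Rightarrow> real" where
  "legendre_int p = integral {0..pi} (\<lambda>\<theta>. poly p (cos \<theta>) * sin \<theta>)"

lemma legendre_int_add: "legendre_int (p + q) = legendre_int p + legendre_int q"
  unfolding legendre_int_def
  by (subst Henstock_Kurzweil_Integration.integral_add[symmetric])
     (auto intro!: integrable_continuous_real continuous_intros simp: algebra_simps)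

lemma legendre_int_smult: "legendre_int (smult c p) = c * legendre_int p"
  unfolding legendre_int_def by (simp add: mult.assoc)

lemma legendre_int_pderiv: "legendre_int (pderiv q) = poly q 1 - poly q (- 1)"
proof -
  have "((\<lambda>\<theta>. poly (pderiv q) (cos \<theta>) * sin \<theta>) has_integral (- poly q (cos pi) - (- poly q (cos 0)))) {0..pi}"
    by (rule fundamental_theorem_of_calculus)
       (auto intro!: derivative_eq_intros poly_DERIV[THEN DERIV_chain2] simp: has_real_derivative_iff_has_vector_derivative[symmetric])
  then show ?thesis
    unfolding legendre_int_def by (simp add: integral_unique)
qed

text \<open>One integration by parts moves a derivative from the second factor to the first. Since the orders
  sum to \<open>l + l'\<close>, one of the two factors in each boundary term is differentiated too few times not to
  vanish at \<open>\<plusminus> 1\<close>.\<close>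

lemma legendre_int_parts:
  assumes "a + b = l + l'"
  shows "legendre_int ((pderiv ^^ a) ([:-1, 0, 1:] ^ l) * (pderiv ^^ b) ([:-1, 0, 1:] ^ l')) =
     (-1) ^ b * legendre_int ((pderiv ^^ (l + l')) ([:-1, 0, 1:] ^ l) * [:-1, 0, 1:] ^ l')"
  using assms
proof (induction b arbitrary: a)
  case (Suc b)
  let ?u = "(pderiv ^^ a) ([:-1, 0, 1:] ^ l) :: real poly" and ?v = "(pderiv ^^ b) ([:-1, 0, 1:] ^ l') :: real poly"
  have "a < l \<or> b < l'" using Suc.prems by auto
  then have z: "poly (?u * ?v) 1 = 0" "poly (?u * ?v) (- 1) = 0"
    by (auto simp: higher_pderiv_quadratic_power_zero)
  then have "legendre_int (pderiv (?u * ?v)) = 0"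
    unfolding legendre_int_pderiv z by simp
  then have "legendre_int (?u * pderiv ?v) = - legendre_int (pderiv ?u * ?v)"
    by (simp add: pderiv_mult legendre_int_add mult.commute)
  also have "\<dots> = - ((-1) ^ b * legendre_int ((pderiv ^^ (l + l')) ([:-1, 0, 1:] ^ l) * [:-1, 0, 1:] ^ l'))"
    using Suc.IH[of "Suc a"] Suc.prems by simp
  finally show ?case by simp
qed simp

lemma degree_quadratic_power: "degree ([:-1, 0, 1 :: real:] ^ l) = 2 * l" "lead_coeff ([:-1, 0, 1 :: real:] ^ l) = 1"
  by (simp add: degree_power_eq, subst lead_coeff_power, simp)

text \<open>The antiderivative \<open>x (x\<^sup>2 - 1)\<^sup>l\<^sup>+\<^sup>1\<close> vanishes at both ends, which relates the integrals for \<open>l\<close> and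
  \<open>l + 1\<close>.\<close>

lemma legendre_int_quadratic_power:
  "legendre_int ([:-1, 0, 1:] ^ l) * fact (2 * l + 1) = (-1) ^ l * 2 ^ (2 * l + 1) * (fact l)\<^sup>2"
proof (induction l)
  case 0
  have "pderiv [:0, 1 :: real:] = 1" by (simp add: pderiv_pCons)
  then show ?case using legendre_int_pderiv[of "[:0, 1:]"] by simp
next
  case (Suc l)
  let ?w = "[:-1, 0, 1 :: real:]"
  have "pderiv ([:0, 1:] * ?w ^ Suc l) = smult (2 * real l + 3) (?w ^ Suc l) + smult (2 * real l + 2) (?w ^ l)"
    by (rule poly_ext, simp only: pderiv_mult pderiv_power_Suc)
       (simp add: pderiv_pCons algebra_simps)
  then have "(2 * real l + 3) * legendre_int (?w ^ Suc l) + (2 * real l + 2) * legendre_int (?w ^ l) = 0"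
    using legendre_int_pderiv[of "[:0, 1:] * ?w ^ Suc l"] by (simp add: legendre_int_add legendre_int_smult)
  then have *: "(2 * real l + 3) * legendre_int (?w ^ Suc l) = - (2 * real l + 2) * legendre_int (?w ^ l)"
    by (simp only: eq_neg_iff_add_eq_0 mult_minus_left)
  have "fact (2 * Suc l + 1) = (2 * real l + 3) * (2 * real l + 2) * fact (2 * l + 1)"
    by (simp add: algebra_simps)
  then have "legendre_int (?w ^ Suc l) * fact (2 * Suc l + 1) = 
     ((2 * real l + 3) * legendre_int (?w ^ Suc l)) * (2 * real l + 2) * fact (2 * l + 1)"
    by simp
  also have "\<dots> = - (2 * real l + 2)\<^sup>2 * (legendre_int (?w ^ l) * fact (2 * l + 1))"
    unfolding * power2_eq_square by (simp only: mult_minus_left mult_minus_right mult_ac)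
  also have "\<dots> = (-1) ^ Suc l * 2 ^ (2 * Suc l + 1) * (fact (Suc l))\<^sup>2"
    unfolding Suc by (simp add: power2_eq_square algebra_simps)
  finally show ?case .
qed

text \<open>After all derivatives are moved to one factor, the polynomial of smaller degree is differentiated
  to zero; for \<open>l = l'\<close> it becomes the constant \<open>(2 l)!\<close>.\<close>

lemma legendre_int_orthogonal:
  assumes "\<bar>m\<bar> \<le> int l" "\<bar>m\<bar> \<le> int l'"
  shows "legendre_int (legendre_poly l (- m) * legendre_poly l' m) =
    (if l = l' then (-1) powi m * 2 * (fact l)\<^sup>2 / ((2 * real l + 1) * fact (nat (int l - m)) * fact (nat (int l + m))) else 0)"
proof -
  let ?w = "[:-1, 0, 1 :: real:]"
  define a b where "a = nat (int l - m)" and "b = nat (int l' + m)"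
  have ab: "a + b = l + l'" and m: "int a = int l - m" "int b = int l' + m"
    using assms by (auto simp: a_def b_def)
  define T where "T = legendre_int ((pderiv ^^ (l + l')) (?w ^ l) * ?w ^ l')"
  have "legendre_int (legendre_poly l (- m) * legendre_poly l' m) =
     legendre_int ((pderiv ^^ a) (?w ^ l) * (pderiv ^^ b) (?w ^ l')) / (fact a * 2 ^ l * fact b * 2 ^ l')"
    using m by (simp add: legendre_poly_def a_def[symmetric] b_def[symmetric] legendre_int_smult)
  then have I: "legendre_int (legendre_poly l (- m) * legendre_poly l' m) = (-1) ^ b * T / (fact a * 2 ^ l * fact b * 2 ^ l')"
    unfolding legendre_int_parts[OF ab] T_def .
  show ?thesis
  proof (cases "l = l'")
    case False
    have "T = 0"
    proof (cases "l < l'")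
      case True
      then have "(pderiv ^^ (l + l')) (?w ^ l) = 0"
        by (intro poly_eqI) (simp add: coeff_higher_pderiv coeff_eq_0 degree_quadratic_power)
      then show ?thesis by (simp add: T_def legendre_int_def)
    next
      case False
      with \<open>l \<noteq> l'\<close> have "(pderiv ^^ (l + l')) (?w ^ l') = 0"
        by (intro poly_eqI) (simp add: coeff_higher_pderiv coeff_eq_0 degree_quadratic_power)
      then show ?thesis
        using legendre_int_parts[of 0 "l + l'" l l'] by (simp add: T_def legendre_int_def)
    qed
    then show ?thesis using False I by simp
  next
    case True
    have "(pderiv ^^ (l + l)) (?w ^ l) = [:fact (2 * l):]"
    proof (rule poly_eqI)
      fix k show "coeff ((pderiv ^^ (l + l)) (?w ^ l)) k = coeff [:fact (2 * l):] k"
        using degree_quadratic_power[of l]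
        by (cases k) (simp_all add: coeff_higher_pderiv coeff_eq_0 pochhammer_fact mult_2)
    qed
    then have "T = fact (2 * l) * legendre_int (?w ^ l)"
      by (simp add: T_def True[symmetric] legendre_int_smult)
    also have "\<dots> = fact (2 * l) * ((-1) ^ l * 2 ^ (2 * l + 1) * (fact l)\<^sup>2 / fact (2 * l + 1))"
      unfolding legendre_int_quadratic_power[symmetric] by simp
    also have "\<dots> = (-1) ^ l * 2 ^ (2 * l + 1) * (fact l)\<^sup>2 / (2 * real l + 1)"
      by (simp add: divide_simps) (simp add: algebra_simps)?
    finally have T: "T = (-1) ^ l * 2 ^ (2 * l + 1) * (fact l)\<^sup>2 / (2 * real l + 1)" .
    have "(-1) ^ b * (-1) ^ l = ((-1) powi m :: real)"
    proof -
      have "m = int b - int l" using m(2) True by simp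
      then have "(-1) powi m = ((-1) ^ b / (-1) ^ l :: real)"
        by (simp add: power_int_diff)
      then show ?thesis by (simp add: minus_one_power_iff)
    qed
    then have "(-1) ^ b * T / (fact a * 2 ^ l * fact b * 2 ^ l') = (-1) powi m * (2 ^ (2 * l + 1) * (fact l)\<^sup>2 / (2 * real l + 1)) / (fact a * 2 ^ l * fact b * 2 ^ l)"
      unfolding T True by (simp add: mult.assoc[symmetric])
    also have "\<dots> = (-1) powi m * 2 * (fact l)\<^sup>2 / ((2 * real l + 1) * fact a * fact b)"
    proof -
      have *: "x * (2 * (y * y) * f / d) / (u * y * v * y) = x * 2 * f / (d * u * v)" if "y \<noteq> 0" for x y f d u v :: real
        using that by (simp add: mult_ac)
      have "2 ^ (2 * l + 1) = 2 * (2 ^ l * 2 ^ l :: real)"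
        by (simp only: mult_2[of l] power_add power_one_right)
      then show ?thesis
        by (simp only:) (rule *, simp)
    qed
    finally show ?thesis
      using I True by (simp add: a_def b_def)
  qed
qed

section \<open>Polar coordinates in space\<close>

definition polar :: "real ^ 3 \<Rightarrow> real ^ 3" where
  "polar x = (x $ 1) *\<^sub>R unit_vec (x $ 2, x $ 3)"

definition polar_jacobian :: "real ^ 3 \<Rightarrow> real ^ 3 ^ 3" where
  "polar_jacobian x = (let r = x $ 1; \<theta> = x $ 2; \<phi> = x $ 3 in vector
     [vector [sin \<theta> * cos \<phi>, r * cos \<theta> * cos \<phi>, - r * sin \<theta> * sin \<phi>],
      vector [sin \<theta> * sin \<phi>, r * cos \<theta> * sin \<phi>, r * sin \<theta> * cos \<phi>],
      vector [cos \<theta>, - r * sin \<theta>, 0]])"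

lemma polar_nth:
  "polar x $ 1 = x $ 1 * (sin (x $ 2) * cos (x $ 3))"
  "polar x $ 2 = x $ 1 * (sin (x $ 2) * sin (x $ 3))"
  "polar x $ 3 = x $ 1 * cos (x $ 2)"
  by (simp_all add: polar_def unit_vec_def)

lemma has_derivative_polar: "(polar has_derivative (*v) (polar_jacobian x)) (at x within S)"
proof -
  have nth: "((\<lambda>x. x $ i) has_derivative (\<lambda>h. h $ i)) (at x within S)" for i :: 3
    by (intro bounded_linear_imp_has_derivative bounded_linear_vec_nth)
  have "((\<lambda>x. polar x $ i) has_derivative (\<lambda>h. (polar_jacobian x *v h) $ i)) (at x within S)" for i
  proof -
    have "((\<lambda>x. polar x $ 1) has_derivative (\<lambda>h. (polar_jacobian x *v h) $ 1)) (at x within S)"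
      "((\<lambda>x. polar x $ 2) has_derivative (\<lambda>h. (polar_jacobian x *v h) $ 2)) (at x within S)"
      "((\<lambda>x. polar x $ 3) has_derivative (\<lambda>h. (polar_jacobian x *v h) $ 3)) (at x within S)"
      unfolding polar_nth
      by (rule has_derivative_eq_rhs, (rule has_derivative_mult has_derivative_sin has_derivative_cos nth)+,
          simp add: fun_eq_iff polar_jacobian_def Let_def matrix_vector_mult_def sum_3, (simp add: algebra_simps)?)+
    then show ?thesis using exhaust_3[of i] by auto
  qed
  then show ?thesis
    by (subst has_derivative_componentwise_within) (auto simp: Basis_vec_def inner_axis)
qed

lemma det_polar_jacobian: "det (polar_jacobian x) = (x $ 1)\<^sup>2 * sin (x $ 2)"
proof -
  define r \<theta> \<phi> where "r = x $ 1" and "\<theta> = x $ 2" and "\<phi> = x $ 3"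
  have "det (polar_jacobian x) = r\<^sup>2 * sin \<theta>"
    unfolding det_3 polar_jacobian_def Let_def vector_3 r_def[symmetric] \<theta>_def[symmetric] \<phi>_def[symmetric]
    using sin_cos_squared_add[of \<theta>] sin_cos_squared_add[of \<phi>] by algebra
  then show ?thesis by (simp add: r_def \<theta>_def)
qed

text \<open>A domain on which \<open>polar\<close> is injective and whose image misses only part of the plane \<open>y = 0\<close>.\<close>

definition polar_domain :: "(real ^ 3) set" where
  "polar_domain = {x. 0 < x $ 1 \<and> 0 < x $ 2 \<and> x $ 2 < pi \<and> 0 < x $ 3 \<and> x $ 3 < 2 * pi}"

lemma inj_on_polar: "inj_on polar polar_domain"
proof (rule inj_onI)
  fix x y assume x: "x \<in> polar_domain" and y: "y \<in> polar_domain" and eq: "polar x = polar y"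
  have "norm (polar x) = x $ 1" "norm (polar y) = y $ 1"
    using x y by (simp_all add: polar_def norm_unit_vec polar_domain_def)
  then have 1: "x $ 1 = y $ 1" using eq by simp
  have pos: "y $ 1 > 0" using y by (simp add: polar_domain_def)
  have "cos (x $ 2) = cos (y $ 2)"
    using arg_cong[OF eq, of "\<lambda>v. v $ 3"] 1 pos by (simp add: polar_nth)
  then have 2: "x $ 2 = y $ 2"
    by (rule cos_inj_pi[rotated 4]) (use x y in \<open>simp_all add: polar_domain_def\<close>)
  have "sin (y $ 2) > 0"
    using y by (intro sin_gt_zero) (auto simp: polar_domain_def)
  then have "cos (x $ 3) = cos (y $ 3)" "sin (x $ 3) = sin (y $ 3)"
    using arg_cong[OF eq, of "\<lambda>v. v $ 1"] arg_cong[OF eq, of "\<lambda>v. v $ 2"] 1 2 pos by (simp_all add: polar_nth)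
  then obtain n :: int where n: "x $ 3 = y $ 3 + 2 * pi * n"
    using sin_cos_eq_iff by metis
  have "\<bar>2 * pi * n\<bar> < 2 * pi * 1"
    using x y n by (auto simp: polar_domain_def)
  then have "\<bar>real_of_int n\<bar> < 1"
    by (simp add: abs_mult)
  then have "n = 0" by linarith
  then have 3: "x $ 3 = y $ 3" using n by simp
  show "x = y"
    unfolding vec_eq_iff forall_3 using 1 2 3 by simp
qed

lemma polar_image: "v $ 2 \<noteq> 0 \<Longrightarrow> v \<in> polar ` polar_domain"
proof -
  assume v: "v $ 2 \<noteq> 0"
  define r where "r = norm v"
  have "v \<noteq> 0" using v by auto
  then have r: "r > 0" by (simp add: r_def)
  have sq: "(v $ 1)\<^sup>2 + (v $ 2)\<^sup>2 + (v $ 3)\<^sup>2 = r\<^sup>2"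
    by (simp add: r_def norm_vec_def L2_set_def sum_3)
  have "(v $ 3)\<^sup>2 < r\<^sup>2"
    using sq v by (smt (verit) zero_less_power2 zero_le_power2)
  then have "\<bar>v $ 3\<bar> < r"
    using r power2_less_imp_less[of "\<bar>v $ 3\<bar>" r] by simp
  then have b: "-1 < v $ 3 / r" "v $ 3 / r < 1"
    using r by (auto simp: field_simps)
  define \<theta> where "\<theta> = arccos (v $ 3 / r)"
  have \<theta>: "0 < \<theta>" "\<theta> < pi" and c: "cos \<theta> = v $ 3 / r"
    using arccos_lt_bounded[OF b] b unfolding \<theta>_def by (auto intro: cos_arccos)
  have s: "sin \<theta> > 0" using \<theta> by (rule sin_gt_zero)
  have "(r * sin \<theta>)\<^sup>2 = r\<^sup>2 - (r * cos \<theta>)\<^sup>2"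
    by (simp add: power_mult_distrib sin_squared_eq algebra_simps)
  also have "\<dots> = (v $ 1)\<^sup>2 + (v $ 2)\<^sup>2"
    using sq r by (simp add: c)
  finally have rs: "(r * sin \<theta>)\<^sup>2 = (v $ 1)\<^sup>2 + (v $ 2)\<^sup>2" .
  have "(v $ 1 / (r * sin \<theta>))\<^sup>2 + (v $ 2 / (r * sin \<theta>))\<^sup>2 = 1"
    unfolding power_divide rs add_divide_distrib[symmetric] using v by (simp add: sum_power2_eq_zero_iff)
  then obtain t where t: "0 \<le> t" "t < 2 * pi" "v $ 1 / (r * sin \<theta>) = cos t" "v $ 2 / (r * sin \<theta>) = sin t"
    by (rule sincos_total_2pi)
  have "t \<noteq> 0" using t(4) v r s by auto
  with t have "vector [r, \<theta>, t] \<in> polar_domain"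
    using r \<theta> by (simp add: polar_domain_def)
  moreover have "v = polar (vector [r, \<theta>, t])"
    unfolding vec_eq_iff forall_3 polar_nth vector_3 c t(3)[symmetric] t(4)[symmetric] using r s by simp
  ultimately show ?thesis by blast
qed

lemma continuous_on_unit_vec: "continuous_on S unit_vec"
proof -
  have "continuous_on S (\<lambda>x. unit_vec x $ i)" for i
  proof -
    have "continuous_on S (\<lambda>x. unit_vec x $ 1)" "continuous_on S (\<lambda>x. unit_vec x $ 2)"
      "continuous_on S (\<lambda>x. unit_vec x $ 3)"
      unfolding unit_vec_def case_prod_beta vector_3 by (intro continuous_intros)+
    then show ?thesis
      using exhaust_3[of i] by auto
  qed
  then have "continuous_on S (\<lambda>x. \<chi> i. unit_vec x $ i)"
    by (intro continuous_on_vec_lambda)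
  then show ?thesis by simp
qed

lemma continuous_on_polar: "continuous_on S polar"
  using has_derivative_continuous_on[OF has_derivative_polar] by blast

lemma borel_measurable_polar [measurable]: "polar \<in> borel_measurable borel"
  by (intro borel_measurable_continuous_onI continuous_on_polar)

lemma measurable_vec_nth [measurable]: "(\<lambda>x. x $ i) \<in> borel_measurable (borel :: (real ^ 3) measure)"
  by (intro borel_measurable_continuous_onI continuous_intros)

lemma polar_domain_borel [measurable]: "polar_domain \<in> sets borel"
  unfolding polar_domain_def by measurable

text \<open>It suffices to compare both measures on boxes. There the formula for the measure of a differentiable
  image applies, as the part of a box missed by \<open>polar\<close> is negligible.\<close>

lemma lborel_eq_polar:
  "(lborel :: (real ^ 3) measure) =
     distr (density lborel (\<lambda>x. ennreal (indicator polar_domain x * ((x $ 1)\<^sup>2 * sin (x $ 2))))) borel polar"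
    (is "_ = distr (density lborel ?d) borel polar")
proof (rule lborel_eqI)
  fix l u :: "real ^ 3"
  assume le: "\<And>b. b \<in> Basis \<Longrightarrow> l \<bullet> b \<le> u \<bullet> b"
  define S where "S = polar_domain \<inter> polar -` box l u"
  have S [measurable]: "S \<in> sets borel"
    unfolding S_def by measurable
  have im: "polar ` S = polar ` polar_domain \<inter> box l u"
    by (auto simp: S_def)
  have hyper: "negligible {v :: real ^ 3. v $ 2 = 0}"
    by (rule negligible_standard_hyperplane_cart)
  have neg: "negligible (sym_diff (box l u) (polar ` S))"
    by (rule negligible_subset[OF hyper]) (use polar_image im in blast)
  have box: "box l u \<in> lmeasurable" by simp
  have "polar ` S \<in> lmeasurable \<and> measure lebesgue (polar ` S) = measure lebesgue (box l u)"
    using measure_negligible_symdiff[OF box neg] lmeasurable_negligible_symdiff[OF box neg] by blast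
  then have int: "((\<lambda>x. \<bar>det (polar_jacobian x)\<bar>) has_integral measure lebesgue (box l u)) S"
    using has_measure_differentiable_image[of S polar "\<lambda>x. (*v) (polar_jacobian x)" "measure lebesgue (box l u)"]
      has_derivative_polar inj_on_subset[OF inj_on_polar, of S] S
    by (simp add: S_def sets_completionI_sets)
  have "emeasure (distr (density lborel ?d) borel polar) (box l u) =
     (\<integral>\<^sup>+x. ?d x * indicator (polar -` box l u) x \<partial>lborel)"
    by (simp add: emeasure_distr emeasure_density measurable_sets_borel[OF borel_measurable_polar])
  also have "\<dots> = (\<integral>\<^sup>+x. ennreal (indicator S x * \<bar>det (polar_jacobian x)\<bar>) \<partial>lborel)"
  proof (rule nn_integral_cong)
    fix x
    have "sin (x $ 2) > 0" if "x \<in> polar_domain"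
      using that by (intro sin_gt_zero) (auto simp: polar_domain_def)
    then show "?d x * indicator (polar -` box l u) x = ennreal (indicator S x * \<bar>det (polar_jacobian x)\<bar>)"
      by (auto simp: S_def det_polar_jacobian indicator_def abs_mult)
  qed
  also have "\<dots> = ennreal (measure lebesgue (box l u))"
    by (rule nn_integral_has_integral_lebesgue[OF _ int]) simp
  also have "measure lebesgue (box l u) = (\<Prod>b\<in>Basis. (u - l) \<bullet> b)"
    using le by (simp add: measure_lborel_box_eq)
  finally show "emeasure (distr (density lborel ?d) borel polar) (box l u) = ennreal (\<Prod>b\<in>Basis. (u - l) \<bullet> b)" .
qed simp

definition vec_of_triple :: "real \<times> real \<times> real \<Rightarrow> real ^ 3" where
  "vec_of_triple = (\<lambda>(x, y, z). vector [x, y, z])"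

lemma vec_of_triple_nth [simp]:
  "vec_of_triple x $ 1 = fst x" "vec_of_triple x $ 2 = fst (snd x)" "vec_of_triple x $ 3 = snd (snd x)"
  by (simp_all add: vec_of_triple_def case_prod_beta)

lemma continuous_on_vec_of_triple: "continuous_on S vec_of_triple"
proof -
  have "continuous_on S (\<lambda>x. vec_of_triple x $ i)" for i
  proof -
    have "continuous_on S (\<lambda>x. vec_of_triple x $ 1)" "continuous_on S (\<lambda>x. vec_of_triple x $ 2)"
      "continuous_on S (\<lambda>x. vec_of_triple x $ 3)"
      unfolding vec_of_triple_nth by (intro continuous_intros)+
    then show ?thesis
      using exhaust_3[of i] by auto
  qed
  then have "continuous_on S (\<lambda>x. \<chi> i. vec_of_triple x $ i)"
    by (intro continuous_on_vec_lambda)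
  then show ?thesis by simp
qed

lemma borel_measurable_vec_of_triple [measurable]: "vec_of_triple \<in> borel_measurable borel"
  by (intro borel_measurable_continuous_onI continuous_on_vec_of_triple)

lemma lborel_eq_vec_of_triple: "(lborel :: (real ^ 3) measure) = distr lborel borel vec_of_triple"
proof (rule lborel_eqI)
  fix l u :: "real ^ 3"
  assume le: "\<And>b. b \<in> Basis \<Longrightarrow> l \<bullet> b \<le> u \<bullet> b"
  have le': "l $ i \<le> u $ i" for i
  proof -
    have "axis i (1 :: real) \<in> Basis" by (simp add: axis_in_Basis_iff)
    from le[OF this] show ?thesis by (simp add: inner_axis)
  qed
  have "vec_of_triple -` box l u = {l $ 1<..<u $ 1} \<times> ({l $ 2<..<u $ 2} \<times> {l $ 3<..<u $ 3})"
    by (auto simp: mem_box_cart forall_3)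
  then have "emeasure (distr lborel borel vec_of_triple) (box l u) =
     emeasure (lborel \<Otimes>\<^sub>M (lborel \<Otimes>\<^sub>M lborel)) ({l $ 1<..<u $ 1} \<times> ({l $ 2<..<u $ 2} \<times> {l $ 3<..<u $ 3}))"
    by (simp add: emeasure_distr lborel_prod)
  also have "\<dots> = ennreal (u $ 1 - l $ 1) * (ennreal (u $ 2 - l $ 2) * ennreal (u $ 3 - l $ 3))"
  proof -
    have "sigma_finite_measure (lborel \<Otimes>\<^sub>M lborel :: (real \<times> real) measure)"
      unfolding lborel_prod by (rule lborel.sigma_finite_measure_axioms)
    then show ?thesis
      using le' by (subst sigma_finite_measure.emeasure_pair_measure_Times)
        (simp_all add: lborel.emeasure_pair_measure_Times pair_measureI)
  qed
  also have "\<dots> = ennreal (\<Prod>i\<in>UNIV. (u - l) $ i)"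
  proof -
    have nn: "0 \<le> u $ i - l $ i" for i using le'[of i] by simp
    have "(\<Prod>i\<in>UNIV. (u - l) $ i) = (u $ 1 - l $ 1) * ((u $ 2 - l $ 2) * (u $ 3 - l $ 3))"
      unfolding UNIV_3 by simp
    then show ?thesis
      by (simp only: ennreal_mult[OF nn mult_nonneg_nonneg[OF nn nn]] ennreal_mult[OF nn nn])
  qed
  also have "(\<Prod>i\<in>UNIV. (u - l) $ i) = (\<Prod>b\<in>Basis. (u - l) \<bullet> b)"
  proof -
    have B: "(Basis :: (real ^ 3) set) = (\<lambda>i. axis i 1) ` UNIV"
      by (auto simp: Basis_vec_def)
    have "inj (\<lambda>i :: 3. axis i (1 :: real))"
      by (auto intro: injI simp: axis_eq_axis)
    then show ?thesis
      unfolding B by (simp add: prod.reindex inner_axis)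
  qed
  finally show "emeasure (distr lborel borel vec_of_triple) (box l u) = ennreal (\<Prod>b\<in>Basis. (u - l) \<bullet> b)" .
qed simp

abbreviation radial_measure :: "real measure" where
  "radial_measure \<equiv> density lborel (\<lambda>r. ennreal (indicator {0<..} r * r\<^sup>2))"

abbreviation angular_density :: "real \<times> real \<Rightarrow> real" where
  "angular_density x \<equiv> indicator ({0..pi} \<times> {0..2 * pi}) x * sin (fst x)"

lemma angular_density_nonneg: "angular_density x \<ge> 0"
  by (auto simp: indicator_def intro: sin_ge_zero)

lemma sphere_measure_eq:
  "sphere_measure = distr (density lborel (\<lambda>x. ennreal (angular_density x))) (restrict_space borel (sphere 0 1)) unit_vec"
proof -
  have "(\<lambda>(\<theta>, \<phi>). indicator ({0..pi} \<times> {0..2 * pi}) (\<theta>, \<phi>) * ennreal (sin \<theta>)) = (\<lambda>x. ennreal (angular_density x))"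
    by (auto simp: fun_eq_iff indicator_def)
  then show ?thesis by (simp add: sphere_measure_def)
qed

lemma borel_measurable_angular_density [measurable]: "(\<lambda>x. angular_density x) \<in> borel_measurable borel"
  unfolding borel_prod[symmetric] by measurable

lemma finite_angular: "finite_measure (density lborel (\<lambda>x. ennreal (angular_density x)))"
proof (rule finite_measureI)
  have "emeasure (density lborel (\<lambda>x. ennreal (angular_density x))) UNIV = (\<integral>\<^sup>+x. ennreal (angular_density x) \<partial>lborel)"
    by (simp add: emeasure_density)
  also have "\<dots> \<le> (\<integral>\<^sup>+x. indicator (cbox (0, 0) (pi, 2 * pi)) x \<partial>lborel)"
    by (rule nn_integral_mono) (auto simp: indicator_def cbox_Pair_eq)
  also have "\<dots> = emeasure lborel (cbox (0, 0) (pi, 2 * pi))"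
    by simp
  also have "\<dots> < \<infinity>"
    by (rule emeasure_lborel_cbox_finite)
  finally show "emeasure (density lborel (\<lambda>x. ennreal (angular_density x)))
     (space (density lborel (\<lambda>x. ennreal (angular_density x)))) \<noteq> \<infinity>" by simp
qed

lemma unit_vec_measurable [measurable]:
  "unit_vec \<in> density lborel (\<lambda>x. ennreal (angular_density x)) \<rightarrow>\<^sub>M restrict_space borel (sphere 0 1)"
  using measurable_unit_vec by (simp cong: measurable_cong_sets)

lemma finite_sphere_measure: "finite_measure sphere_measure"
  unfolding sphere_measure_eq by (intro finite_measure.finite_measure_distr[OF finite_angular] unit_vec_measurable)

lemma sigma_finite_radial: "sigma_finite_measure radial_measure"
  by (subst sigma_finite_measure.sigma_finite_iff_density_finite'[OF lborel.sigma_finite_measure_axioms]) auto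

text \<open>The Jacobian \<open>r\<^sup>2 sin \<theta>\<close> is a product, so the density of \<open>lborel_eq_polar\<close> splits into the radial
  density and the one defining \<open>sphere_measure\<close>. The two densities differ only where \<open>\<phi>\<close> is \<open>0\<close> or \<open>2 \<pi>\<close>.\<close>

theorem lborel_eq_radial_sphere:
  "(lborel :: (real ^ 3) measure) = distr (radial_measure \<Otimes>\<^sub>M sphere_measure) borel (\<lambda>(r, n). r *\<^sub>R n)"
proof -
  let ?A = "density lborel (\<lambda>x. ennreal (angular_density x))"
  interpret A: finite_measure ?A by (rule finite_angular)
  interpret S: finite_measure sphere_measure by (rule finite_sphere_measure)
  let ?R = "restrict_space borel (sphere (0 :: real ^ 3) 1)"
  have [measurable]: "(\<lambda>(r, n). r *\<^sub>R n) \<in> borel_measurable (borel \<Otimes>\<^sub>M ?R)"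
  proof -
    have "(\<lambda>x. snd x) \<in> borel_measurable ((borel :: real measure) \<Otimes>\<^sub>M ?R)"
      by (rule measurable_compose[OF measurable_snd measurable_restrict_space1]) simp
    then show ?thesis
      unfolding case_prod_beta by measurable
  qed
  have 1: "radial_measure \<Otimes>\<^sub>M sphere_measure =
     distr (radial_measure \<Otimes>\<^sub>M ?A) (borel \<Otimes>\<^sub>M ?R) (\<lambda>(r, a). (r, unit_vec a))"
  proof -
    have "distr radial_measure borel (\<lambda>r. r) \<Otimes>\<^sub>M sphere_measure =
       distr (radial_measure \<Otimes>\<^sub>M ?A) (borel \<Otimes>\<^sub>M ?R) (\<lambda>(r, a). (r, unit_vec a))"
      unfolding sphere_measure_eq
      by (rule pair_measure_distr) (auto simp flip: sphere_measure_eq intro: S.sigma_finite_measure_axioms)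
    moreover have "distr radial_measure borel (\<lambda>r. r) = radial_measure"
      by (rule distr_id2) simp
    ultimately show ?thesis by simp
  qed
  have 2: "radial_measure \<Otimes>\<^sub>M ?A =
     density lborel (\<lambda>(r, a). ennreal (indicator {0<..} r * r\<^sup>2) * ennreal (angular_density a))"
  proof -
    have "radial_measure \<Otimes>\<^sub>M ?A =
       density (lborel \<Otimes>\<^sub>M lborel) (\<lambda>(r, a). ennreal (indicator {0<..} r * r\<^sup>2) * ennreal (angular_density a))"
      by (rule pair_measure_density)
         (auto intro: lborel.sigma_finite_measure_axioms A.sigma_finite_measure_axioms)
    then show ?thesis by (simp only: lborel_prod)
  qed
  have 3: "AE x in lborel. ennreal (indicator polar_domain (vec_of_triple x) * ((vec_of_triple x $ 1)\<^sup>2 * sin (vec_of_triple x $ 2)))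
     = (\<lambda>(r, a). ennreal (indicator {0<..} r * r\<^sup>2) * ennreal (angular_density a)) x"
  proof -
    have "negligible ({x :: real ^ 3. x $ 3 = 0} \<union> {x. x $ 3 = 2 * pi})"
    proof -
      have "negligible {x :: real ^ 3. axis 3 1 \<bullet> x = c}" for c
        by (rule negligible_hyperplane) (simp add: axis_eq_0_iff)
      then show ?thesis by (simp add: inner_axis')
    qed
    then have "{x :: real ^ 3. x $ 3 = 0} \<union> {x. x $ 3 = 2 * pi} \<in> null_sets lborel"
      by (subst (asm) negligible_iff_null_sets, subst (asm) null_sets_completion_iff) auto
    then have "AE v in (lborel :: (real ^ 3) measure). v $ 3 \<noteq> 0 \<and> v $ 3 \<noteq> 2 * pi"
      by (auto dest!: AE_not_in)
    then have "AE x in (lborel :: (real \<times> real \<times> real) measure). snd (snd x) \<noteq> 0 \<and> snd (snd x) \<noteq> 2 * pi"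
      unfolding lborel_eq_vec_of_triple by (subst (asm) AE_distr_iff) (auto intro: measurable_completion)
    then show ?thesis
    proof eventually_elim
      case (elim x)
      obtain r \<theta> \<phi> where x: "x = (r, \<theta>, \<phi>)" by (metis surj_pair)
      show ?case
      proof (cases "\<theta> = 0 \<or> \<theta> = pi")
        case True
        then show ?thesis by (auto simp: x)
      next
        case False
        then show ?thesis
          using elim by (auto simp: x polar_domain_def indicator_def ennreal_mult' intro!: sin_ge_zero)
      qed
    qed
  qed
  let ?p = "(\<lambda>(r, n). r *\<^sub>R n) \<circ> (\<lambda>(r, a). (r, unit_vec a))"
  have "distr (radial_measure \<Otimes>\<^sub>M sphere_measure) borel (\<lambda>(r, n). r *\<^sub>R n) = distr (radial_measure \<Otimes>\<^sub>M ?A) borel ?p"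
    unfolding 1 by (subst distr_distr) auto
  also have "\<dots> = distr (density lborel (\<lambda>x. ennreal (indicator polar_domain (vec_of_triple x) *
       ((vec_of_triple x $ 1)\<^sup>2 * sin (vec_of_triple x $ 2))))) borel (polar \<circ> vec_of_triple)"
  proof -
    have "?p = polar \<circ> vec_of_triple"
      by (auto simp: fun_eq_iff polar_def)
    moreover have "(\<lambda>x. ennreal (indicator polar_domain (vec_of_triple x) *
       ((vec_of_triple x $ 1)\<^sup>2 * sin (vec_of_triple x $ 2)))) \<in> borel_measurable lborel"
    proof -
      have "(\<lambda>x :: real ^ 3. ennreal (indicator polar_domain x * ((x $ 1)\<^sup>2 * sin (x $ 2)))) \<in> borel_measurable borel"
        by measurable
      from measurable_compose[OF borel_measurable_vec_of_triple this] show ?thesis by simp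
    qed
    moreover have "(\<lambda>(r, a). ennreal (indicator {0<..} r * r\<^sup>2) * ennreal (angular_density a)) \<in> borel_measurable lborel"
    proof -
      have "(\<lambda>(r, a). ennreal (indicator {0<..} r * r\<^sup>2) * ennreal (angular_density a)) \<in> borel_measurable (borel \<Otimes>\<^sub>M borel)"
        by measurable
      then show ?thesis unfolding borel_prod by simp
    qed
    ultimately show ?thesis
      unfolding 2 using 3 by (intro distr_cong density_cong) auto
  qed
  also have "\<dots> = lborel"
    by (subst lborel_eq_polar, subst lborel_eq_vec_of_triple, subst density_distr, measurable, subst distr_distr) auto
  finally show ?thesis ..
qed

section \<open>Integrals of radial functions times homogeneous functions\<close>

lemma product_integral:
  fixes f :: "'a \<Rightarrow> complex" and g :: "'b \<Rightarrow> complex"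
  assumes "sigma_finite_measure M" "sigma_finite_measure N" and f: "integrable M f" and g: "integrable N g"
  shows "integrable (M \<Otimes>\<^sub>M N) (\<lambda>x. f (fst x) * g (snd x))"
    and "(LINT x|(M \<Otimes>\<^sub>M N). f (fst x) * g (snd x)) = integral\<^sup>L M f * integral\<^sup>L N g"
proof -
  interpret pair_sigma_finite M N
    using assms by (simp add: pair_sigma_finite_def)
  have [measurable]: "f \<in> borel_measurable M" "g \<in> borel_measurable N"
    using f g by auto
  show I: "integrable (M \<Otimes>\<^sub>M N) (\<lambda>x. f (fst x) * g (snd x))"
    by (rule Fubini_integrable) (use f g in \<open>simp_all add: norm_mult\<close>)
  show "(LINT x|(M \<Otimes>\<^sub>M N). f (fst x) * g (snd x)) = integral\<^sup>L M f * integral\<^sup>L N g"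
    using integral_fst'[OF I] by simp
qed

lemma sphere_measure_space [simp]: "space sphere_measure = sphere 0 1"
  by (simp add: sphere_measure_def space_restrict_space)

lemma sphere_measurable_cong:
  "measurable sphere_measure N = measurable (restrict_space borel (sphere 0 1)) N"
  by (rule measurable_cong_sets) (simp_all add: sphere_measure_def)

lemma measurable_sphere:
  "f \<in> borel_measurable borel \<Longrightarrow> f \<in> borel_measurable sphere_measure"
  unfolding sphere_measurable_cong by (rule measurable_restrict_space1)

lemma integrable_sphere:
  fixes P :: "real ^ 3 \<Rightarrow> complex"
  assumes "continuous_on UNIV P"
  shows "integrable sphere_measure P"
proof -
  interpret S: finite_measure sphere_measure by (rule finite_sphere_measure)
  have "compact (P ` sphere 0 1)"
    by (intro compact_continuous_image continuous_on_subset[OF assms]) auto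
  then obtain B where "\<And>v. v \<in> sphere 0 1 \<Longrightarrow> norm (P v) \<le> B"
    by (meson bounded_iff compact_imp_bounded imageI)
  then show ?thesis
    by (intro S.integrable_const_bound[of _ B]) 
       (auto intro!: AE_I2 borel_measurable_continuous_onI assms measurable_sphere)
qed

text \<open>At the point \<open>r n\<close> the integrand is \<open>h(r) r\<^sup>d\<close> times \<open>P n\<close>, so Fubini's theorem separates the variables;
  the remaining \<open>r\<^sup>2\<close> is the radial density.\<close>

lemma lborel_radial_homogeneous:
  fixes P :: "real ^ 3 \<Rightarrow> complex" and h :: "real \<Rightarrow> real"
  assumes P: "continuous_on UNIV P" and hom: "\<And>c v. P (c *\<^sub>R v) = of_real c ^ d * P v"
    and [measurable]: "h \<in> borel_measurable borel"
    and int: "set_integrable lborel {0<..} (\<lambda>r. h r * r ^ (d + 2))"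
  shows "integrable lborel (\<lambda>v. of_real (h (norm v)) * P v)"
    and "(LINT v|lborel. of_real (h (norm v)) * P v) =
      of_real (LINT r:{0<..}|lborel. h r * r ^ (d + 2)) * (LINT n|sphere_measure. P n)"
proof -
  interpret S: finite_measure sphere_measure by (rule finite_sphere_measure)
  have [measurable]: "P \<in> borel_measurable borel"
    using P by (rule borel_measurable_continuous_onI)
  let ?F = "\<lambda>v. of_real (h (norm v)) * P v"
  let ?f = "\<lambda>r. complex_of_real (h \<bar>r\<bar> * r ^ d)"
  have sm: "(\<lambda>(r, n). r *\<^sub>R n) \<in> borel_measurable (radial_measure \<Otimes>\<^sub>M sphere_measure)"
  proof -
    have "(\<lambda>x. snd x) \<in> borel_measurable (radial_measure \<Otimes>\<^sub>M sphere_measure)"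
      by (rule measurable_compose[OF measurable_snd measurable_sphere]) simp
    then show ?thesis
      unfolding case_prod_beta by measurable
  qed
  have F: "?F (case x of (r, n) \<Rightarrow> r *\<^sub>R n) = ?f (fst x) * P (snd x)"
    if "x \<in> space (radial_measure \<Otimes>\<^sub>M sphere_measure)" for x
    using that by (auto simp: space_pair_measure hom)
  have d: "(indicator {0<..} r * r\<^sup>2) *\<^sub>R ?f r = of_real (indicator {0<..} r *\<^sub>R (h r * r ^ (d + 2)))" for r :: real
    by (cases "0 < r") (simp_all add: scaleR_conv_of_real power_add power2_eq_square)
  have f: "integrable radial_measure ?f" "integral\<^sup>L radial_measure ?f = of_real (LINT r:{0<..}|lborel. h r * r ^ (d + 2))"
  proof -
    have "integrable radial_measure ?f \<longleftrightarrow> integrable lborel (\<lambda>r. (indicator {0<..} r * r\<^sup>2) *\<^sub>R ?f r)"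
      by (rule integrable_density) auto
    then show "integrable radial_measure ?f"
      using int unfolding d set_integrable_def by (simp only: complex_of_real_integrable_eq)
    have "integral\<^sup>L radial_measure ?f = (LINT r|lborel. (indicator {0<..} r * r\<^sup>2) *\<^sub>R ?f r)"
      by (rule integral_density) auto
    then show "integral\<^sup>L radial_measure ?f = of_real (LINT r:{0<..}|lborel. h r * r ^ (d + 2))"
      unfolding d set_lebesgue_integral_def integral_complex_of_real .
  qed
  note prod = product_integral[OF sigma_finite_radial S.sigma_finite_measure_axioms f(1) integrable_sphere[OF P]]
  have Fm: "?F \<in> borel_measurable borel" by measurable
  have "integrable (radial_measure \<Otimes>\<^sub>M sphere_measure) (\<lambda>x. ?F (case x of (r, n) \<Rightarrow> r *\<^sub>R n))"
    using prod(1) by (subst Bochner_Integration.integrable_cong[OF refl F])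
  then have "integrable (distr (radial_measure \<Otimes>\<^sub>M sphere_measure) borel (\<lambda>(r, n). r *\<^sub>R n)) ?F"
    unfolding integrable_distr_eq[OF sm Fm] .
  then show "integrable lborel ?F"
    unfolding lborel_eq_radial_sphere[symmetric] .
  have "(LINT v|lborel. ?F v) = (LINT x|(radial_measure \<Otimes>\<^sub>M sphere_measure). ?F (case x of (r, n) \<Rightarrow> r *\<^sub>R n))"
    unfolding integral_distr[OF sm Fm, symmetric] lborel_eq_radial_sphere[symmetric] ..
  also have "\<dots> = (LINT x|(radial_measure \<Otimes>\<^sub>M sphere_measure). ?f (fst x) * P (snd x))"
    by (rule Bochner_Integration.integral_cong[OF refl F])
  also have "\<dots> = of_real (LINT r:{0<..}|lborel. h r * r ^ (d + 2)) * (LINT n|sphere_measure. P n)"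
    unfolding prod(2) f(2) ..
  finally show "(LINT v|lborel. ?F v) = of_real (LINT r:{0<..}|lborel. h r * r ^ (d + 2)) * (LINT n|sphere_measure. P n)" .
qed

lemma gamma_moment_integral:
  assumes "\<mu> > -1"
  shows "(\<lambda>x. x powr \<mu> * exp (- x) * poly p x) absolutely_integrable_on {0<..}"
    and "integral {0<..} (\<lambda>x. x powr \<mu> * exp (- x) * poly p x) = gamma_moment \<mu> p"
proof -
  have G: "((\<lambda>x. x powr (\<mu> + real k) * exp (- x)) has_integral Gamma (\<mu> + 1 + real k)) {0<..}" for k
  proof -
    have "((\<lambda>x. x powr (\<mu> + 1 + real k - 1) / exp x) has_integral Gamma (\<mu> + 1 + real k)) {0..}"
      using assms by (intro Gamma_integral_real) simp
    then have "((\<lambda>x. x powr (\<mu> + real k) * exp (- x)) has_integral Gamma (\<mu> + 1 + real k)) {0..}"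
      by (simp add: exp_minus divide_inverse)
    moreover have 1: "negligible {x \<in> {0..} - {0<..}. x powr (\<mu> + real k) * exp (- x) \<noteq> 0}"
      by (rule negligible_subset[of "{0}"]) auto
    moreover have 2: "negligible {x \<in> {0<..} - {0..}. x powr (\<mu> + real k) * exp (- x) \<noteq> 0}"
      by (rule negligible_subset[of "{0}"]) auto
    ultimately show ?thesis
      by (simp only: has_integral_spike_set_eq[OF 1 2])
  qed
  have eq: "x powr \<mu> * exp (- x) * poly p x = (\<Sum>k\<le>degree p. coeff p k * (x powr (\<mu> + real k) * exp (- x)))" if "x \<in> {0<..}" for x
    using that by (simp add: poly_altdef sum_distrib_left powr_add powr_realpow mult_ac)
  have A: "(\<lambda>x. \<Sum>k\<le>degree p. coeff p k * (x powr (\<mu> + real k) * exp (- x))) absolutely_integrable_on {0<..}"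
  proof (rule absolutely_integrable_sum)
    fix k
    have "(\<lambda>x. x powr (\<mu> + real k) * exp (- x)) absolutely_integrable_on {0<..}"
      by (rule nonnegative_absolutely_integrable_1) (use G in \<open>auto simp: integrable_on_def\<close>)
    then show "(\<lambda>x. coeff p k * (x powr (\<mu> + real k) * exp (- x))) absolutely_integrable_on {0<..}"
      by (rule set_integrable_mult_right)
  qed simp
  show "(\<lambda>x. x powr \<mu> * exp (- x) * poly p x) absolutely_integrable_on {0<..}"
    by (rule absolutely_integrable_spike[OF A negligible_empty]) (simp add: eq)
  have "((\<lambda>x. \<Sum>k\<le>degree p. coeff p k * (x powr (\<mu> + real k) * exp (- x))) has_integral gamma_moment \<mu> p) {0<..}"
    unfolding gamma_moment_def by (intro has_integral_sum has_integral_mult_right G) simp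
  then show "integral {0<..} (\<lambda>x. x powr \<mu> * exp (- x) * poly p x) = gamma_moment \<mu> p"
    by (intro integral_unique) (rule has_integral_eq[rotated], auto simp: eq)
qed

text \<open>The substitution \<open>x = r\<^sup>2 / 2\<close>.\<close>

lemma radial_gamma_moment:
  assumes "\<mu> > -1"
  shows "set_integrable lborel {0<..} (\<lambda>r. r powr (2 * \<mu> + 1) * exp (- r\<^sup>2 / 2) * poly p (r\<^sup>2 / 2))" (is "set_integrable _ _ ?f")
    and "(LINT r:{0<..}|lborel. r powr (2 * \<mu> + 1) * exp (- r\<^sup>2 / 2) * poly p (r\<^sup>2 / 2)) = 2 powr \<mu> * gamma_moment \<mu> p"
proof -
  let ?g = "\<lambda>r :: real. r\<^sup>2 / 2"
  let ?h = "\<lambda>x. x powr \<mu> * exp (- x) * poly p x"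
  have im: "?g ` {0<..} = {0<..}"
  proof (intro equalityI subsetI)
    fix x :: real assume "x \<in> {0<..}"
    then show "x \<in> ?g ` {0<..}" by (intro image_eqI[of _ _ "sqrt (2 * x)"]) auto
  qed auto
  have "(\<lambda>r. \<bar>r\<bar> * ?h (?g r)) absolutely_integrable_on {0<..} \<and>
      integral {0<..} (\<lambda>r. \<bar>r\<bar> * ?h (?g r)) = gamma_moment \<mu> p
      \<longleftrightarrow> ?h absolutely_integrable_on (?g ` {0<..}) \<and> integral (?g ` {0<..}) ?h = gamma_moment \<mu> p"
    by (rule has_absolute_integral_change_of_variables_1')
       (auto intro!: derivative_eq_intros inj_onI simp: power2_eq_iff_nonneg)
  then have 1: "(\<lambda>r. \<bar>r\<bar> * ?h (?g r)) absolutely_integrable_on {0<..}"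
    "integral {0<..} (\<lambda>r. \<bar>r\<bar> * ?h (?g r)) = gamma_moment \<mu> p"
    unfolding im using gamma_moment_integral[OF assms, of p] by auto
  have eq: "?f r = 2 powr \<mu> * (\<bar>r\<bar> * ?h (?g r))" if "r \<in> {0<..}" for r
  proof -
    have "(r\<^sup>2) powr \<mu> = r powr (2 * \<mu>)"
      using that powr_powr[of r 2 \<mu>] by (simp add: powr_numeral)
    then have "r powr (2 * \<mu> + 1) = r * (r\<^sup>2) powr \<mu>"
      using that unfolding powr_add by simp
    also have "(r\<^sup>2) powr \<mu> = 2 powr \<mu> * (r\<^sup>2 / 2) powr \<mu>"
      unfolding powr_divide by simp
    finally show ?thesis using that by simp
  qed
  have "(\<lambda>r. 2 powr \<mu> * (\<bar>r\<bar> * ?h (?g r))) absolutely_integrable_on {0<..}"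
    by (rule set_integrable_mult_right) (rule 1(1))
  then have A: "?f absolutely_integrable_on {0<..}"
    by (rule absolutely_integrable_spike[OF _ negligible_empty]) (simp only: Diff_empty eq)
  have [measurable]: "(\<lambda>r. poly p (r\<^sup>2 / 2)) \<in> borel_measurable borel"
    by (intro borel_measurable_continuous_onI continuous_intros) simp
  show I: "set_integrable lborel {0<..} ?f"
    using A unfolding set_integrable_def by (subst (asm) integrable_completion) measurable
  have "(LINT r:{0<..}|lborel. ?f r) = integral {0<..} ?f"
    by (rule set_borel_integral_eq_integral(2)[OF I])
  also have "\<dots> = integral {0<..} (\<lambda>r. 2 powr \<mu> * (\<bar>r\<bar> * ?h (?g r)))"
    by (rule Henstock_Kurzweil_Integration.integral_cong) (rule eq)
  also have "\<dots> = 2 powr \<mu> * gamma_moment \<mu> p"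
    unfolding 1(2)[symmetric] by simp
  finally show "(LINT r:{0<..}|lborel. ?f r) = 2 powr \<mu> * gamma_moment \<mu> p" .
qed

section \<open>Orthogonality on the sphere\<close>

lemma set_integrable_continuous_interval:
  fixes f :: "real \<Rightarrow> 'a :: euclidean_space"
  assumes "continuous_on UNIV f"
  shows "set_integrable lborel {a..b} f"
  unfolding set_integrable_def
  by (rule borel_integrable_compact) (auto intro: continuous_on_subset[OF assms])

lemma integral_cis:
  "(LINT \<phi>:{0..2 * pi}|lborel. cis (of_int k * \<phi>)) = (if k = 0 then of_real (2 * pi) else 0)"
proof -
  have "(LINT \<phi>:{0..2 * pi}|lborel. cis (of_int k * \<phi>)) = integral {0..2 * pi} (\<lambda>\<phi>. cis (of_int k * \<phi>))"
    by (intro set_borel_integral_eq_integral set_integrable_continuous_interval continuous_intros)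
  also have "\<dots> = (if k = 0 then of_real (2 * pi) else 0)"
  proof (cases "k = 0")
    case True
    then show ?thesis by (simp add: scaleR_conv_of_real)
  next
    case False
    let ?F = "\<lambda>\<phi>. cis (of_int k * \<phi>) / (\<i> * of_int k)"
    have "((\<lambda>\<phi>. cis (of_int k * \<phi>)) has_integral (?F (2 * pi) - ?F 0)) {0..2 * pi}"
    proof (rule fundamental_theorem_of_calculus)
      fix \<phi> :: real
      have "((\<lambda>z. exp (\<i> * of_int k * z) / (\<i> * of_int k)) has_field_derivative exp (\<i> * of_int k * of_real \<phi>)) (at (of_real \<phi>))"
        using False by (auto intro!: derivative_eq_intros)
      then have "((\<lambda>\<phi>. exp (\<i> * of_int k * of_real \<phi>) / (\<i> * of_int k)) has_vector_derivative exp (\<i> * of_int k * of_real \<phi>)) (at \<phi> within {0..2 * pi})"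
        by (rule has_vector_derivative_real_field)
      then show "(?F has_vector_derivative cis (of_int k * \<phi>)) (at \<phi> within {0..2 * pi})"
        by (simp add: cis_conv_exp mult.assoc)
    qed simp
    moreover have "cis (of_int k * (2 * pi)) = 1"
      using cis_multiple_2pi[of "of_int k"] by (simp add: mult.commute mult.left_commute)
    ultimately show ?thesis using False by (simp add: integral_unique)
  qed
  finally show ?thesis .
qed

lemma continuous_on_solid: "continuous_on S (solid l m)"
proof (induction l arbitrary: m)
  case (Suc l)
  have "continuous_on S xy_plus" "continuous_on S xy_minus"
    by (auto simp: xy_plus_def[abs_def] xy_minus_def[abs_def] Complex_eq intro!: continuous_intros)
  then show ?case
    using Suc by (auto simp: solid.simps(2)[abs_def] intro!: continuous_intros)
qed auto

lemma sphere_integral_eq: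
  fixes P :: "real ^ 3 \<Rightarrow> complex"
  assumes P: "continuous_on UNIV P"
  shows "(LINT n|sphere_measure. P n) =
    (LINT \<theta>:{0..pi}|lborel. of_real (sin \<theta>) * (LINT \<phi>:{0..2 * pi}|lborel. P (unit_vec (\<theta>, \<phi>))))"
proof -
  have [measurable]: "P \<in> borel_measurable borel"
    using P by (rule borel_measurable_continuous_onI)
  have c: "continuous_on UNIV (\<lambda>x. P (unit_vec x))"
    by (intro continuous_on_compose2[OF P] continuous_on_unit_vec) auto
  then have [measurable]: "(\<lambda>x. P (unit_vec x)) \<in> borel_measurable borel"
    by (rule borel_measurable_continuous_onI)
  have "(LINT n|sphere_measure. P n) = (LINT x|density lborel (\<lambda>x. ennreal (angular_density x)). P (unit_vec x))"
    unfolding sphere_measure_eq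
    by (rule integral_distr[OF unit_vec_measurable]) (rule measurable_restrict_space1, simp)
  also have "\<dots> = (LINT x|lborel. angular_density x *\<^sub>R P (unit_vec x))"
    by (rule integral_density) (auto intro: angular_density_nonneg)
  also have "\<dots> = (LINT x|(lborel \<Otimes>\<^sub>M lborel). angular_density x *\<^sub>R P (unit_vec x))"
    by (simp only: lborel_prod)
  also have "\<dots> = (LINT \<theta>|lborel. LINT \<phi>|lborel. angular_density (\<theta>, \<phi>) *\<^sub>R P (unit_vec (\<theta>, \<phi>)))"
  proof (rule lborel_pair.integral_fst'[symmetric])
    have "continuous_on UNIV (\<lambda>x. sin (fst x) *\<^sub>R P (unit_vec x))"
      by (intro continuous_intros c)
    then have "integrable lborel (\<lambda>x. indicator (cbox (0, 0) (pi, 2 * pi)) x *\<^sub>R (sin (fst x) *\<^sub>R P (unit_vec x)))"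
      by (intro borel_integrable_compact compact_cbox) (rule continuous_on_subset[OF _ subset_UNIV])
    also have "(\<lambda>x. indicator (cbox (0, 0) (pi, 2 * pi)) x *\<^sub>R (sin (fst x) *\<^sub>R P (unit_vec x))) =
       (\<lambda>x. angular_density x *\<^sub>R P (unit_vec x))"
      by (auto simp: fun_eq_iff indicator_def cbox_Pair_eq)
    finally show "integrable (lborel \<Otimes>\<^sub>M lborel) (\<lambda>x. angular_density x *\<^sub>R P (unit_vec x))"
      by (simp only: lborel_prod)
  qed
  also have "\<dots> = (LINT \<theta>:{0..pi}|lborel. of_real (sin \<theta>) * (LINT \<phi>:{0..2 * pi}|lborel. P (unit_vec (\<theta>, \<phi>))))"
    unfolding set_lebesgue_integral_def
  proof (rule Bochner_Integration.integral_cong[OF refl])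
    fix \<theta>
    have "(LINT \<phi>|lborel. angular_density (\<theta>, \<phi>) *\<^sub>R P (unit_vec (\<theta>, \<phi>))) =
       (LINT \<phi>|lborel. (indicator {0..pi} \<theta> * sin \<theta>) *\<^sub>R (indicator {0..2 * pi} \<phi> *\<^sub>R P (unit_vec (\<theta>, \<phi>))))"
      by (rule Bochner_Integration.integral_cong[OF refl]) (auto simp: indicator_def)
    then show "(LINT \<phi>|lborel. angular_density (\<theta>, \<phi>) *\<^sub>R P (unit_vec (\<theta>, \<phi>))) =
       indicator {0..pi} \<theta> *\<^sub>R (of_real (sin \<theta>) * (LINT \<phi>|lborel. indicator {0..2 * pi} \<phi> *\<^sub>R P (unit_vec (\<theta>, \<phi>))))"
      by (simp add: scaleR_conv_of_real mult.assoc)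
  qed
  finally show ?thesis .
qed

text \<open>The factor \<open>cis ((m' - m) \<phi>)\<close> integrates to zero unless \<open>m = m'\<close>; then the powers of \<open>sin \<theta>\<close> cancel because
  conjugation turns \<open>m\<close> into \<open>- m\<close>, and a polynomial in \<open>cos \<theta>\<close> remains.\<close>

lemma sphere_integral_solid:
  assumes m: "\<bar>m\<bar> \<le> int l" "\<bar>m'\<bar> \<le> int l'"
  shows "(LINT n|sphere_measure. cnj (solid l m n) * solid l' m' n) =
    (if l = l' \<and> m = m' then of_real (4 * pi * (fact l)\<^sup>2 / ((2 * real l + 1) * fact (nat (int l - m)) * fact (nat (int l + m)))) else 0)"
proof -
  define Q where "Q = legendre_poly l (- m) * legendre_poly l' m'"
  have inner: "of_real (sin \<theta>) * (LINT \<phi>:{0..2 * pi}|lborel. cnj (solid l m (unit_vec (\<theta>, \<phi>))) * solid l' m' (unit_vec (\<theta>, \<phi>)))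
     = (if m = m' then of_real (2 * pi * (- 1) powi m * (poly Q (cos \<theta>) * sin \<theta>)) else 0)"
    if "\<theta> \<in> {0..pi}" for \<theta>
  proof (cases "sin \<theta> = 0")
    case False
    define z where "z = \<i> * of_real (sin \<theta>)"
    have z: "z \<noteq> 0" using False by (simp add: z_def)
    have "cnj (solid l m (unit_vec (\<theta>, \<phi>))) * solid l' m' (unit_vec (\<theta>, \<phi>)) =
       ((- 1) powi m * z powi (m' - m) * of_real (poly Q (cos \<theta>))) * cis (of_int (m' - m) * \<phi>)" for \<phi>
    proof -
      define \<zeta> where "\<zeta> = z * cis \<phi>"
      have \<zeta>: "\<zeta> = \<i> * Complex (unit_vec (\<theta>, \<phi>) $ 1) (unit_vec (\<theta>, \<phi>) $ 2)" "\<zeta> \<noteq> 0"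
        using z by (simp add: \<zeta>_def z_def unit_vec_def complex_eq_iff, simp add: \<zeta>_def)
      have S: "solid l m (unit_vec (\<theta>, \<phi>)) = \<zeta> powi m * of_real (poly (legendre_poly l m) (cos \<theta>))" for l m
        using solid_eq_legendre[OF norm_unit_vec \<zeta>] by (simp add: unit_vec_def)
      have "\<zeta> powi (- m) * \<zeta> powi m' = \<zeta> powi (m' - m)"
        using \<zeta>(2) by (simp add: power_int_add[symmetric])
      also have "\<dots> = z powi (m' - m) * cis (of_int (m' - m) * \<phi>)"
        by (simp add: \<zeta>_def power_int_mult_distrib cis_power_int)
      finally have "\<zeta> powi (- m) * \<zeta> powi m' = z powi (m' - m) * cis (of_int (m' - m) * \<phi>)" .
      then show ?thesis
        unfolding cnj_solid unfolding S Q_def by (simp add: mult_ac)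
    qed
    then have "(LINT \<phi>:{0..2 * pi}|lborel. cnj (solid l m (unit_vec (\<theta>, \<phi>))) * solid l' m' (unit_vec (\<theta>, \<phi>))) =
       ((- 1) powi m * z powi (m' - m) * of_real (poly Q (cos \<theta>))) * (if m' - m = 0 then of_real (2 * pi) else 0)"
      by (simp only: set_integral_mult_right integral_cis)
    then show ?thesis
      by auto
  qed simp
  have "(LINT n|sphere_measure. cnj (solid l m n) * solid l' m' n) =
     (LINT \<theta>:{0..pi}|lborel. of_real (sin \<theta>) * (LINT \<phi>:{0..2 * pi}|lborel. cnj (solid l m (unit_vec (\<theta>, \<phi>))) * solid l' m' (unit_vec (\<theta>, \<phi>))))"
    by (intro sphere_integral_eq continuous_intros continuous_on_solid)
  also have "\<dots> = (LINT \<theta>:{0..pi}|lborel. if m = m' then of_real (2 * pi * (- 1) powi m * (poly Q (cos \<theta>) * sin \<theta>)) else 0)"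
    by (rule set_lebesgue_integral_cong) (use inner in auto)
  also have "\<dots> = (if m = m' then of_real (2 * pi * (- 1) powi m * legendre_int Q) else 0)"
  proof (cases "m = m'")
    case True
    have "(LINT \<theta>:{0..pi}|lborel. 2 * pi * (- 1) powi m * (poly Q (cos \<theta>) * sin \<theta>)) = 2 * pi * (- 1) powi m * legendre_int Q"
      unfolding set_integral_mult_right legendre_int_def
      by (subst set_borel_integral_eq_integral)
         (auto intro!: set_integrable_continuous_interval continuous_intros)
    then show ?thesis
      using True by (simp only: simp_thms if_True set_integral_complex_of_real)
  qed (simp add: set_lebesgue_integral_def)
  also have "\<dots> = (if l = l' \<and> m = m' then of_real (4 * pi * (fact l)\<^sup>2 / ((2 * real l + 1) * fact (nat (int l - m)) * fact (nat (int l + m)))) else 0)"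
  proof -
    have "(- 1) powi m * (- 1) powi m = (1 :: real)"
      by (simp add: power_int_mult_distrib[symmetric])
    then have *: "2 * pi * (- 1) powi m * ((- 1) powi m * 2 * x / y) = 4 * pi * x / y" for x y
      by (simp add: field_simps)
    show ?thesis
      using m legendre_int_orthogonal[of m l l'] unfolding Q_def by (auto simp only: * split: if_splits) auto
  qed
  finally show ?thesis .
qed

section \<open>Orthonormality of the Burnett functions and the product formula\<close>

definition burnett_norm :: "nat \<times> int \<times> nat \<Rightarrow> complex" where
  "burnett_norm = (\<lambda>(l, m, n).
     of_real (sqrt (2 powi (1 - int l) * pi powr (3 / 2) * fact n / Gamma (real n + real l + 3 / 2))) * sph_norm l m)"

lemma burnett_eq:
  assumes "a \<in> burnett_indices N" "v \<noteq> 0"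
  shows "burnett a v = burnett_norm a * burnett_fun a v"
proof -
  obtain l m n where a: "a = (l, m, n)" and m: "\<bar>m\<bar> \<le> int l"
    using assms(1) by (auto simp: burnett_indices_def)
  have "sph_harm l m (v /\<^sub>R norm v) = sph_norm l m * solid l m (v /\<^sub>R norm v)"
    using assms(2) m by (intro sph_harm_eq_solid) auto
  moreover have "solid l m v = of_real (norm v) ^ l * solid l m (v /\<^sub>R norm v)"
    using assms(2) by (simp add: solid_scaleR[symmetric])
  ultimately show ?thesis
    using assms(2) by (simp add: a burnett_def burnett_norm_def burnett_fun_def laguerre_eq_poly add_ac)
qed

text \<open>The weight is only required to agree with \<open>r powr \<delta>\<close> for positive \<open>r\<close>, so that the constant weight
  \<open>1\<close> is covered by \<open>\<delta> = 0\<close> although \<open>0 powr 0 = 0\<close>.\<close>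

lemma weighted_laguerre_integral:
  fixes P :: "real ^ 3 \<Rightarrow> complex" and w :: "real \<Rightarrow> real" and m n d :: nat and \<alpha> \<kappa> \<delta> \<mu> :: real
  assumes P: "continuous_on UNIV P" "\<And>c v. P (c *\<^sub>R v) = of_real c ^ d * P v"
    and w: "w \<in> borel_measurable borel" "\<And>r. 0 < r \<Longrightarrow> w r = r powr \<delta>"
    and \<mu>: "\<mu> = (\<delta> + real d + 1) / 2" "\<mu> > -1"
  defines "h \<equiv> \<lambda>r. w r * poly (laguerre_poly m \<alpha>) (r\<^sup>2 / 2) * poly (laguerre_poly n \<kappa>) (r\<^sup>2 / 2) * ((2 * pi) powr (- 3 / 2) * exp (- r\<^sup>2 / 2))"
  shows "integrable lborel (\<lambda>v. of_real (h (norm v)) * P v)"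
    and "(LINT v|lborel. of_real (h (norm v)) * P v) =
       of_real ((2 * pi) powr (- 3 / 2) * (2 powr \<mu> * K_sum \<mu> \<alpha> \<kappa> m n)) * (LINT n|sphere_measure. P n)"
proof -
  let ?p = "laguerre_poly m \<alpha> * laguerre_poly n \<kappa>"
  let ?f = "\<lambda>r. (2 * pi) powr (- 3 / 2) * (r powr (2 * \<mu> + 1) * exp (- r\<^sup>2 / 2) * poly ?p (r\<^sup>2 / 2))"
  have eq: "h r * r ^ (d + 2) = ?f r" if "r \<in> {0<..}" for r
  proof -
    have "r powr (2 * \<mu> + 1) = r powr \<delta> * r powr real (d + 2)"
      unfolding powr_add[symmetric] by (rule arg_cong) (simp add: \<mu>(1) field_simps)
    also have "r powr real (d + 2) = r ^ (d + 2)"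
      using that by (intro powr_realpow) simp
    finally show ?thesis
      using that by (simp only: h_def w(2) greaterThan_iff poly_mult mult_ac)
  qed
  have c: "(\<lambda>r. poly (laguerre_poly k \<beta>) (r\<^sup>2 / 2)) \<in> borel_measurable borel" for k \<beta>
    by (intro borel_measurable_continuous_onI continuous_intros) simp
  have h: "h \<in> borel_measurable borel"
    unfolding h_def by (intro borel_measurable_times w(1) c) auto
  have I: "set_integrable lborel {0<..} ?f"
    by (rule set_integrable_mult_right) (rule radial_gamma_moment(1)[OF \<mu>(2)])
  then have int: "set_integrable lborel {0<..} (\<lambda>r. h r * r ^ (d + 2))"
    by (subst set_integrable_cong[OF refl refl eq])
  have val: "(LINT r:{0<..}|lborel. h r * r ^ (d + 2)) = (2 * pi) powr (- 3 / 2) * (2 powr \<mu> * K_sum \<mu> \<alpha> \<kappa> m n)"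
  proof -
    have "(LINT r:{0<..}|lborel. h r * r ^ (d + 2)) = (LINT r:{0<..}|lborel. ?f r)"
      by (rule set_lebesgue_integral_cong) (use eq in auto)
    also have "\<dots> = (2 * pi) powr (- 3 / 2) * (2 powr \<mu> * K_sum \<mu> \<alpha> \<kappa> m n)"
      unfolding set_integral_mult_right radial_gamma_moment(2)[OF \<mu>(2)] gamma_moment_laguerre_K[OF \<mu>(2)] ..
    finally show ?thesis .
  qed
  show "integrable lborel (\<lambda>v. of_real (h (norm v)) * P v)"
    by (rule lborel_radial_homogeneous(1)[OF P h int])
  show "(LINT v|lborel. of_real (h (norm v)) * P v) =
       of_real ((2 * pi) powr (- 3 / 2) * (2 powr \<mu> * K_sum \<mu> \<alpha> \<kappa> m n)) * (LINT n|sphere_measure. P n)"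
    unfolding lborel_radial_homogeneous(2)[OF P h int] val ..
qed

lemma two_powi: "2 powi k = (2 :: real) powr of_int k"
  by (simp add: powr_real_of_int')

lemma sph_norm_sq: "(norm (sph_norm l m))\<^sup>2 =
  (2 * real l + 1) * fact (nat (int l - m)) * fact (nat (int l + m)) / (4 * pi * (fact l)\<^sup>2)"
proof -
  define A B where "A = (fact (nat (int l + m)) :: real)" and "B = (fact (nat (int l - m)) :: real)"
  have pos: "A > 0" "B > 0" by (simp_all add: A_def B_def)
  have "(norm (sph_norm l m))\<^sup>2 = (sqrt ((2 * real l + 1) / (4 * pi) * (B / A)))\<^sup>2 * A\<^sup>2 / (fact l)\<^sup>2"
    unfolding sph_norm_def norm_mult norm_power_int norm_of_real A_def B_def
    by (simp add: power_mult_distrib power_divide)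
  also have "\<dots> = (2 * real l + 1) / (4 * pi) * (B / A) * A\<^sup>2 / (fact l)\<^sup>2"
    using pos by (subst real_sqrt_pow2) auto
  also have "\<dots> = (2 * real l + 1) * B * A / (4 * pi * (fact l)\<^sup>2)"
    using pos by (simp add: power2_eq_square)
  finally show ?thesis by (simp only: A_def B_def)
qed

lemma K_sum_diagonal:
  assumes "\<mu> > -1"
  shows "K_sum \<mu> \<mu> \<mu> n n = Gamma (real n + \<mu> + 1) / fact n"
  unfolding gamma_moment_laguerre_K[OF assms, symmetric] gamma_moment_laguerre[OF assms] by simp

text \<open>Different indices of equal weight differ in \<open>(l, m)\<close>, and the spherical harmonics are orthogonal. For
  equal indices the radial integral is the diagonal value of \<open>K\<close>.\<close>

lemma burnett_fun_orthonormal: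
  assumes a: "a \<in> burnett_indices N" and b: "b \<in> burnett_indices N"
  shows "integrable lborel (\<lambda>v. cnj (burnett_fun a v) * burnett_fun b v * of_real (maxwellian v))"
    and "cnj (burnett_norm a) * burnett_norm a * (LINT v|lborel. cnj (burnett_fun a v) * burnett_fun b v * of_real (maxwellian v)) =
      (if a = b then 1 else 0)"
proof -
  obtain l m n where a: "a = (l, m, n)" "\<bar>m\<bar> \<le> int l" "l + 2 * n = N"
    using a by (auto simp: burnett_indices_def)
  obtain l' m' n' where b: "b = (l', m', n')" "\<bar>m'\<bar> \<le> int l'" "l' + 2 * n' = N"
    using b by (auto simp: burnett_indices_def)
  define \<mu> where "\<mu> = (real (l + l') + 1) / 2"
  have \<mu>: "\<mu> > -1" by (simp add: \<mu>_def)
  let ?P = "\<lambda>v. cnj (solid l m v) * solid l' m' v"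
  have P: "continuous_on UNIV ?P" "\<And>c v. ?P (c *\<^sub>R v) = of_real c ^ (l + l') * ?P v"
    by (auto intro!: continuous_intros continuous_on_solid simp: solid_scaleR power_add)
  have eq: "cnj (burnett_fun a v) * burnett_fun b v * of_real (maxwellian v) =
      of_real (1 * poly (laguerre_poly n (real l + 1 / 2)) ((norm v)\<^sup>2 / 2) * poly (laguerre_poly n' (real l' + 1 / 2)) ((norm v)\<^sup>2 / 2)
        * ((2 * pi) powr (- 3 / 2) * exp (- (norm v)\<^sup>2 / 2))) * ?P v" for v
    by (simp add: a b burnett_fun_def maxwellian_def)
  note W = weighted_laguerre_integral[OF P, of "\<lambda>_. 1" 0 \<mu> n "real l + 1 / 2" n' "real l' + 1 / 2"]
  show "integrable lborel (\<lambda>v. cnj (burnett_fun a v) * burnett_fun b v * of_real (maxwellian v))"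
    unfolding eq by (rule W(1)) (use \<mu> in \<open>simp_all add: \<mu>_def\<close>)
  have I: "(LINT v|lborel. cnj (burnett_fun a v) * burnett_fun b v * of_real (maxwellian v)) =
     of_real ((2 * pi) powr (- 3 / 2) * (2 powr \<mu> * K_sum \<mu> (real l + 1 / 2) (real l' + 1 / 2) n n')) * (LINT n|sphere_measure. ?P n)"
    unfolding eq by (rule W(2)) (use \<mu> in \<open>simp_all add: \<mu>_def\<close>)
  show "cnj (burnett_norm a) * burnett_norm a * (LINT v|lborel. cnj (burnett_fun a v) * burnett_fun b v * of_real (maxwellian v)) =
      (if a = b then 1 else 0)"
  proof (cases "l = l' \<and> m = m'")
    case False
    then show ?thesis
      unfolding I sphere_integral_solid[OF a(2) b(2)] by (auto simp: a b)
  next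
    case True
    then have ab: "a = b" using a b by auto
    have m: "\<mu> = real l + 1 / 2" "real l' + 1 / 2 = real l + 1 / 2" "n' = n"
      using True a b by (auto simp: \<mu>_def)
    define G where "G = Gamma (real n + real l + 3 / 2)"
    have G: "G > 0" unfolding G_def by (rule Gamma_real_pos) simp
    have K: "K_sum \<mu> (real l + 1 / 2) (real l' + 1 / 2) n n' = G / fact n"
      using K_sum_diagonal[OF \<mu>, of n] unfolding m G_def by (simp add: add_ac)
    define Z where "Z = (2 * real l + 1) * fact (nat (int l - m)) * fact (nat (int l + m)) / (4 * pi * (fact l)\<^sup>2)"
    have Z: "Z > 0" by (simp add: Z_def)
    have S: "(LINT n|sphere_measure. ?P n) = of_real (1 / Z)"
      unfolding sphere_integral_solid[OF a(2) b(2)] using True by (simp add: Z_def)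
    have N: "cnj (burnett_norm a) * burnett_norm a = of_real (2 powi (1 - int l) * pi powr (3 / 2) * fact n / G * Z)"
    proof -
      have "cnj (burnett_norm a) * burnett_norm a = of_real ((norm (burnett_norm a))\<^sup>2)"
        by (simp only: complex_norm_square mult.commute)
      also have "(norm (burnett_norm a))\<^sup>2 = 2 powi (1 - int l) * pi powr (3 / 2) * fact n / G * Z"
        using G unfolding Z_def sph_norm_sq[symmetric]
        by (simp add: a burnett_norm_def norm_mult power_mult_distrib G_def[symmetric])
      finally show ?thesis .
    qed
    have c: "2 powi (1 - int l) * pi powr (3 / 2) * ((2 * pi) powr (- 3 / 2) * 2 powr \<mu>) = 1"
    proof -
      have "2 powi (1 - int l) * pi powr (3 / 2) * ((2 * pi) powr (- 3 / 2) * 2 powr \<mu>) =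
         (2 powr (1 - real l) * 2 powr (- 3 / 2) * 2 powr \<mu>) * (pi powr (3 / 2) * pi powr (- 3 / 2))"
        by (simp add: two_powi powr_mult)
      also have "\<dots> = 1"
        unfolding powr_add[symmetric] m by simp
      finally show ?thesis .
    qed
    have "cnj (burnett_norm a) * burnett_norm a * (LINT v|lborel. cnj (burnett_fun a v) * burnett_fun b v * of_real (maxwellian v)) =
      of_real ((2 powi (1 - int l) * pi powr (3 / 2) * ((2 * pi) powr (- 3 / 2) * 2 powr \<mu>)) * (fact n / G * (G / fact n)) * (Z * (1 / Z)))"
      unfolding N I K S by simp
    also have "\<dots> = 1"
      unfolding c using G Z by simp
    finally show ?thesis using ab by simp
  qed
qed

text \<open>Expanding in the Burnett functions and integrating against one of them singles out its
  coefficient. The Burnett polynomial and its smooth form may differ at the origin, which has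
  measure zero.\<close>

lemma hermite_expansion:
  "complex_of_real (hermite \<alpha> v) =
     (\<Sum>a\<in>burnett_indices (msize \<alpha>). burnett_coeff \<alpha> a * burnett_norm a * burnett_fun a v)"
proof -
  let ?I = "burnett_indices (msize \<alpha>)"
  obtain c where c: "(\<lambda>v. complex_of_real (hermite \<alpha> v)) = (\<lambda>v. \<Sum>a\<in>?I. c a * burnett_fun a v)"
    using hermite_in_burnett_span[of \<alpha>] by (auto simp: burnett_span_def)
  have c': "complex_of_real (hermite \<alpha> v) = (\<Sum>a\<in>?I. c a * burnett_fun a v)" for v
    using fun_cong[OF c, of v] .
  have "burnett_coeff \<alpha> a * burnett_norm a = c a" if a: "a \<in> ?I" for a
  proof -
    let ?J = "\<lambda>b. LINT v|lborel. cnj (burnett_fun a v) * burnett_fun b v * of_real (maxwellian v)"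
    let ?g = "\<lambda>v. cnj (burnett_norm a) * (\<Sum>b\<in>?I. c b * (cnj (burnett_fun a v) * burnett_fun b v * of_real (maxwellian v)))"
    let ?f = "\<lambda>v. cnj (burnett a v) * of_real (hermite \<alpha> v) * of_real (maxwellian v)"
    have bm: "(\<lambda>v. cnj (burnett_fun a v) * burnett_fun b v * of_real (maxwellian v)) \<in> borel_measurable borel"
      if "b \<in> ?I" for b
      using borel_measurable_integrable[OF burnett_fun_orthonormal(1)[OF a that]] by simp
    have gm: "?g \<in> borel_measurable borel"
      by (intro borel_measurable_times borel_measurable_sum borel_measurable_const bm)
    have fg: "?f v = ?g v" if "v \<noteq> 0" for v
      unfolding burnett_eq[OF a that] c' sum_distrib_left sum_distrib_right
      by (intro sum.cong refl) (simp only: complex_cnj_mult mult_ac)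
    have "(\<lambda>v. if v \<in> {0} then ?f 0 else ?g v) \<in> borel_measurable borel"
      by (rule measurable_If_set[OF borel_measurable_const gm]) simp
    moreover have "(\<lambda>v. if v \<in> {0} then ?f 0 else ?g v) = ?f"
    proof (rule ext)
      fix v show "(if v \<in> {0} then ?f 0 else ?g v) = ?f v"
        by (cases "v = 0") (simp, simp only: singleton_iff if_False fg simp_thms)
    qed
    ultimately have fm: "?f \<in> borel_measurable borel"
      by (simp only:)
    have "AE v in lborel. ?f v = ?g v"
      using AE_lborel_singleton[of "0 :: real ^ 3"] by (rule AE_mp) (rule AE_I2, rule impI, rule fg)
    then have "burnett_coeff \<alpha> a = (LINT v|lborel. ?g v)"
      unfolding burnett_coeff_def
      using fm gm unfolding measurable_lborel2[symmetric] by (intro integral_cong_AE)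
    also have "\<dots> = cnj (burnett_norm a) * (\<Sum>b\<in>?I. c b * ?J b)"
      by (simp add: Bochner_Integration.integral_sum burnett_fun_orthonormal(1)[OF a])
    finally have "burnett_coeff \<alpha> a * burnett_norm a = (\<Sum>b\<in>?I. c b * (cnj (burnett_norm a) * burnett_norm a * ?J b))"
      by (simp add: sum_distrib_left sum_distrib_right mult_ac)
    also have "\<dots> = (\<Sum>b\<in>?I. if a = b then c b else 0)"
      by (intro sum.cong refl) (simp add: burnett_fun_orthonormal(2)[OF a])
    finally show ?thesis
      using a by (simp add: finite_burnett_indices)
  qed
  then show ?thesis
    unfolding c' by (intro sum.cong) auto
qed

lemma F_int_eq:
  assumes "\<bar>m1\<bar> \<le> int l1" "\<bar>m2\<bar> \<le> int l2"
  shows "F_int s t l1 m1 l2 m2 = sph_norm l1 m1 * sph_norm l2 m2 *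
     (LINT n|sphere_measure. of_real (n $ s * n $ t) * (solid l1 m1 n * solid l2 m2 n))"
proof -
  have "F_int s t l1 m1 l2 m2 = (LINT n|sphere_measure. (sph_norm l1 m1 * sph_norm l2 m2) *
     (of_real (n $ s * n $ t) * (solid l1 m1 n * solid l2 m2 n)))"
    unfolding F_int_def
    by (rule Bochner_Integration.integral_cong) (use assms in \<open>simp_all add: sph_harm_eq_solid\<close>)
  then show ?thesis by simp
qed

text \<open>The powers of \<open>2\<close> and \<open>\<pi>\<close> in the normalizations of the two Burnett polynomials, in the Maxwellian and
  in the radial substitution combine to \<open>2 powr ((\<gamma> + 2) / 2)\<close>.\<close>

lemma radial_constants:
  "sqrt (2 powi (1 - int l1) * pi powr (3 / 2) * fact n1 / Gamma (real n1 + real l1 + 3 / 2)) *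
   sqrt (2 powi (1 - int l2) * pi powr (3 / 2) * fact n2 / Gamma (real n2 + real l2 + 3 / 2)) *
   ((2 * pi) powr (- 3 / 2) * 2 powr ((\<gamma> + real l1 + real l2 + 3) / 2)) =
   2 powr ((\<gamma> + 2) / 2) * D_coeff l1 l2 n1 n2"
proof -
  define X where "X = 2 powr (1 - (real l1 + real l2) / 2) * pi powr (3 / 2)"
  have "X\<^sup>2 = (2 powr (1 - (real l1 + real l2) / 2) * 2 powr (1 - (real l1 + real l2) / 2)) * (pi powr (3 / 2) * pi powr (3 / 2))"
    unfolding X_def power2_eq_square by (simp only: mult_ac)
  also have "2 powr (1 - (real l1 + real l2) / 2) * 2 powr (1 - (real l1 + real l2) / 2) = (2 powi (1 - int l1) * 2 powi (1 - int l2) :: real)"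
    unfolding two_powi powr_add[symmetric] by (rule arg_cong) (simp add: field_simps)
  finally have X: "2 powi (1 - int l1) * 2 powi (1 - int l2) * (pi powr (3 / 2) * pi powr (3 / 2)) = X\<^sup>2" ..
  have "sqrt (2 powi (1 - int l1) * pi powr (3 / 2) * fact n1 / Gamma (real n1 + real l1 + 3 / 2)) *
   sqrt (2 powi (1 - int l2) * pi powr (3 / 2) * fact n2 / Gamma (real n2 + real l2 + 3 / 2)) =
   sqrt (X\<^sup>2 * (fact n1 * fact n2 / (Gamma (real n1 + real l1 + 3 / 2) * Gamma (real n2 + real l2 + 3 / 2))))"
    unfolding X[symmetric] by (simp add: real_sqrt_mult[symmetric] mult_ac)
  also have "\<dots> = X * D_coeff l1 l2 n1 n2"
    unfolding real_sqrt_mult D_coeff_def by (simp add: X_def)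
  finally have 1: "sqrt (2 powi (1 - int l1) * pi powr (3 / 2) * fact n1 / Gamma (real n1 + real l1 + 3 / 2)) *
   sqrt (2 powi (1 - int l2) * pi powr (3 / 2) * fact n2 / Gamma (real n2 + real l2 + 3 / 2)) = X * D_coeff l1 l2 n1 n2" .
  have "X * ((2 * pi) powr (- 3 / 2) * 2 powr ((\<gamma> + real l1 + real l2 + 3) / 2)) =
     (2 powr (1 - (real l1 + real l2) / 2) * 2 powr (- 3 / 2) * 2 powr ((\<gamma> + real l1 + real l2 + 3) / 2)) *
     (pi powr (3 / 2) * pi powr (- 3 / 2))"
    by (simp add: X_def powr_mult)
  also have "\<dots> = 2 powr ((\<gamma> + 2) / 2)"
    unfolding powr_add[symmetric] by (simp, rule arg_cong) (simp add: field_simps)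
  finally show ?thesis
    unfolding 1 by (simp add: mult_ac)
qed

text \<open>One term of the product formula: the direction-dependent factor is homogeneous of degree
  \<open>l\<^sub>1 + l\<^sub>2 + 2\<close>.\<close>

lemma burnett_pair_moment:
  fixes \<gamma> :: real and s t :: 3 and n1 n2 :: nat
  assumes \<gamma>: "\<gamma> > - 5" and m: "\<bar>m1\<bar> \<le> int l1" "\<bar>m2\<bar> \<le> int l2"
  defines "T \<equiv> \<lambda>g :: real ^ 3. of_real (norm g powr \<gamma> * g $ s * g $ t * maxwellian g) *
      (burnett_norm (l1, m1, n1) * burnett_fun (l1, m1, n1) g) * (burnett_norm (l2, m2, n2) * burnett_fun (l2, m2, n2) g)"
  shows "integrable lborel T"
    and "integral\<^sup>L lborel T = of_real (2 powr ((\<gamma> + 2) / 2)) * (of_real (D_coeff l1 l2 n1 n2 *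
          K_sum ((\<gamma> + real l1 + real l2 + 3) / 2) (real l1 + 1 / 2) (real l2 + 1 / 2) n1 n2) * F_int s t l1 m1 l2 m2)"
proof -
  let ?\<mu> = "(\<gamma> + real l1 + real l2 + 3) / 2"
  let ?P = "\<lambda>v :: real ^ 3. of_real (v $ s * v $ t) * (solid l1 m1 v * solid l2 m2 v)"
  let ?c = "burnett_norm (l1, m1, n1) * burnett_norm (l2, m2, n2)"
  have P: "continuous_on UNIV ?P" "\<And>c v. ?P (c *\<^sub>R v) = of_real c ^ (l1 + l2 + 2) * ?P v"
    by (auto intro!: continuous_intros continuous_on_solid simp: solid_scaleR power_add power2_eq_square)
  have T: "T = (\<lambda>v. ?c * (of_real (norm v powr \<gamma> * poly (laguerre_poly n1 (real l1 + 1 / 2)) ((norm v)\<^sup>2 / 2) * poly (laguerre_poly n2 (real l2 + 1 / 2)) ((norm v)\<^sup>2 / 2)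
        * ((2 * pi) powr (- 3 / 2) * exp (- (norm v)\<^sup>2 / 2))) * ?P v))"
    by (simp add: fun_eq_iff T_def burnett_fun_def maxwellian_def mult_ac)
  note W = weighted_laguerre_integral[OF P, of "\<lambda>r. r powr \<gamma>" \<gamma> ?\<mu> n1 "real l1 + 1 / 2" n2 "real l2 + 1 / 2"]
  show "integrable lborel T"
    unfolding T by (intro integrable_mult_right W(1)) (use \<gamma> in \<open>auto simp: field_simps\<close>)
  have "integral\<^sup>L lborel T = ?c * (of_real ((2 * pi) powr (- 3 / 2) * (2 powr ?\<mu> * K_sum ?\<mu> (real l1 + 1 / 2) (real l2 + 1 / 2) n1 n2)) * (LINT n|sphere_measure. ?P n))"
    unfolding T integral_mult_right_zero by (subst W(2)) (use \<gamma> in \<open>auto simp: field_simps\<close>)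
  also have "\<dots> = of_real (
      sqrt (2 powi (1 - int l1) * pi powr (3 / 2) * fact n1 / Gamma (real n1 + real l1 + 3 / 2)) *
      sqrt (2 powi (1 - int l2) * pi powr (3 / 2) * fact n2 / Gamma (real n2 + real l2 + 3 / 2)) *
      ((2 * pi) powr (- 3 / 2) * 2 powr ?\<mu>)) * of_real (K_sum ?\<mu> (real l1 + 1 / 2) (real l2 + 1 / 2) n1 n2) * F_int s t l1 m1 l2 m2"
    unfolding burnett_norm_def prod.case F_int_eq[OF m] of_real_mult by (simp only: mult_ac)
  also have "\<dots> = of_real (2 powr ((\<gamma> + 2) / 2)) * (of_real (D_coeff l1 l2 n1 n2 *
          K_sum ?\<mu> (real l1 + 1 / 2) (real l2 + 1 / 2) n1 n2) * F_int s t l1 m1 l2 m2)"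
    unfolding radial_constants by simp
  finally show "integral\<^sup>L lborel T = of_real (2 powr ((\<gamma> + 2) / 2)) * (of_real (D_coeff l1 l2 n1 n2 *
          K_sum ?\<mu> (real l1 + 1 / 2) (real l2 + 1 / 2) n1 n2) * F_int s t l1 m1 l2 m2)" .
qed

theorem proposition3:
  fixes \<gamma> :: real and p q :: "nat ^ 3" and s t :: 3
  assumes "\<gamma> > - 5"
  shows "integrable lborel (G_integrand s t \<gamma> p q) \<and>
    complex_of_real (G_int s t \<gamma> p q) =
      of_real (2 powr ((\<gamma> + 2) / 2)) *
      (\<Sum>(l1, m1, n1) \<in> burnett_indices (msize p). \<Sum>(l2, m2, n2) \<in> burnett_indices (msize q).
        burnett_coeff p (l1, m1, n1) * burnett_coeff q (l2, m2, n2) *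
        of_real (D_coeff l1 l2 n1 n2 *
          K_sum ((\<gamma> + real l1 + real l2 + 3) / 2) (real l1 + 1 / 2) (real l2 + 1 / 2) n1 n2) *
        F_int s t l1 m1 l2 m2)"
proof -
  let ?I = "burnett_indices (msize p)" and ?J = "burnett_indices (msize q)"
  define T where "T = (\<lambda>a b (g :: real ^ 3). of_real (norm g powr \<gamma> * g $ s * g $ t * maxwellian g) *
      (burnett_norm a * burnett_fun a g) * (burnett_norm b * burnett_fun b g))"
  define V where "V = (\<lambda>(l1, m1 :: int, n1) (l2, m2 :: int, n2). of_real (D_coeff l1 l2 n1 n2 *
      K_sum ((\<gamma> + real l1 + real l2 + 3) / 2) (real l1 + 1 / 2) (real l2 + 1 / 2) n1 n2) * F_int s t l1 m1 l2 m2)"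
  have T: "integrable lborel (T a b)" "integral\<^sup>L lborel (T a b) = of_real (2 powr ((\<gamma> + 2) / 2)) * V a b"
    if ab: "a \<in> ?I" "b \<in> ?J" for a b
  proof -
    obtain l1 m1 n1 l2 m2 n2 where ab: "a = (l1, m1, n1)" "b = (l2, m2, n2)" "\<bar>m1\<bar> \<le> int l1" "\<bar>m2\<bar> \<le> int l2"
      using ab by (auto simp: burnett_indices_def)
    show "integrable lborel (T a b)"
      unfolding T_def ab by (rule burnett_pair_moment(1)[OF assms ab(3,4)])
    show "integral\<^sup>L lborel (T a b) = of_real (2 powr ((\<gamma> + 2) / 2)) * V a b"
      unfolding T_def V_def ab prod.case by (rule burnett_pair_moment(2)[OF assms ab(3,4)])
  qed
  have G: "complex_of_real (G_integrand s t \<gamma> p q g) =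
     (\<Sum>a\<in>?I. \<Sum>b\<in>?J. burnett_coeff p a * burnett_coeff q b * T a b g)" for g
  proof -
    have "complex_of_real (G_integrand s t \<gamma> p q g) =
      of_real (norm g powr \<gamma> * g $ s * g $ t * maxwellian g) * (of_real (hermite p g) * of_real (hermite q g))"
      by (simp add: G_integrand_def)
    also have "\<dots> = (\<Sum>a\<in>?I. \<Sum>b\<in>?J. burnett_coeff p a * burnett_coeff q b * T a b g)"
      unfolding hermite_expansion sum_product unfolding sum_distrib_left T_def
      by (intro sum.cong refl) (simp only: mult_ac)
    finally show ?thesis .
  qed
  have "integrable lborel (\<lambda>g. complex_of_real (G_integrand s t \<gamma> p q g))"
    unfolding G by (intro Bochner_Integration.integrable_sum integrable_mult_right T(1))
  then have int: "integrable lborel (G_integrand s t \<gamma> p q)"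
    by (simp add: complex_of_real_integrable_eq)
  have "complex_of_real (G_int s t \<gamma> p q) = (LINT g|lborel. complex_of_real (G_integrand s t \<gamma> p q g))"
    by (simp add: G_int_def)
  also have "\<dots> = (\<Sum>a\<in>?I. \<Sum>b\<in>?J. burnett_coeff p a * burnett_coeff q b * integral\<^sup>L lborel (T a b))"
    unfolding G by (simp add: Bochner_Integration.integral_sum Bochner_Integration.integrable_sum T(1))
  also have "\<dots> = of_real (2 powr ((\<gamma> + 2) / 2)) * (\<Sum>a\<in>?I. \<Sum>b\<in>?J. burnett_coeff p a * burnett_coeff q b * V a b)"
    unfolding sum_distrib_left by (intro sum.cong refl) (simp add: T(2))
  finally have "complex_of_real (G_int s t \<gamma> p q) =
     of_real (2 powr ((\<gamma> + 2) / 2)) * (\<Sum>a\<in>?I. \<Sum>b\<in>?J. burnett_coeff p a * burnett_coeff q b * V a b)" .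
  with int show ?thesis
    by (simp add: V_def case_prod_beta mult.assoc)
qed

end
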